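(* Let $q=f\,dz^2$ be a holomorphic quadratic differential on the Poincaré disk $\mathbb{D}$ satisfying: (1) $q$ is bounded in the hyperbolic metric on $\mathbb{D}$, i.e. $\|q\|_{\mathbf{g}_{\mathbb{D}}}\le D$ for a positive real number $D$; (2) the first and the second covariant derivatives of $q$ with respect to the linear connection on $T^*\mathbb{D}\otimes_{\mathbb{C}}T^*\mathbb{D}$ are bounded in $\mathbf{g}_{\mathbb{D}}$. Then there exists a harmonic vector field $\chi$ on $\mathbb{D}$ which admits an $L^2$-extension to the closed unit disk $\overline{\mathbb{D}}$ such that $(\mathcal{L}_\chi\mathbf{g}_{\mathbb{D}})^{(2,0)}=q$. Moreover, the restriction of that extension to the boundary circle $\mathbb{S}^1$ is tangential, and $\chi$ is unique up to the addition of holomorphic vector fields on $\mathbb{D}$ which extend tangentially to the boundary circle $\mathbb{S}^1$. Also, $\chi$ is unique up to the addition of elements of the vector space $\mathfrak{g}$ of Killing vector fields on $\mathbb{D}$.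
   Context: $\mathbb{D}=\{|z|<1\}$ carries $\mathbf{g}_{\mathbb{D}}=4(dx^2+dy^2)/(1-|z|^2)^2$; the linear connection is induced by its Levi-Civita connection. Vector fields are identified with $\mathbb{C}$-valued functions. Harmonic vector field: for a smooth map $\phi:U\to \mathbb{D}$ from an open set $U\subseteq \mathbb{D}$, the tension field is $\tau(\phi)=\mathrm{trace}(\nabla d\phi)$, with $\nabla$ the connection on $T^*U\otimes\phi^{-1}T\mathbb{D}$ induced by the Levi-Civita connections. A smooth vector field $\xi$ on $U$ is harmonic if there is a smooth family of smooth maps $\phi_t:U\to \mathbb{D}$, $t\in[0,\epsilon)$, such that $\phi_0$ is the inclusion, $\frac{d\phi_t}{dt}|_{t=0}=\xi$, and $\frac{d}{dt}|_{t=0}\tau(\phi_t)(x)=0$ for all $x\in U$ (computed in the standard coordinates of $\mathbb{C}$). $(2,0)$-part: the trace-free part of the Lie derivative $\mathcal{L}_\xi\mathbf{g}_{\mathbb{D}}$ can be written uniquely as the real part of $h\,dz^2$ with $h$ complex-valued, and $(\mathcal{L}_\xi\mathbf{g}_{\mathbb{D}})^{(2,0)}:=h\,dz^2$. $L^2$-extension: a continuous vector field $X$ on $\mathbb{D}$ has an $L^2$-extension to $\overline{\mathbb{D}}$ if the vector fields $X_\epsilon$ on $\mathbb{S}^1$, obtained by restricting $X$ to the circle of radius $1-\epsilon$ and identifying that circle with $\mathbb{S}^1$ by stretching ($X_\epsilon(z)=X((1-\epsilon)z)$), converge as $\epsilon\to0$ in the Hilbert space of $L^2$-vector fields ($\mathbb{C}$-valued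 functions) on $\mathbb{S}^1$; the limit is the restriction of the extension to $\mathbb{S}^1$. Tangential: an $L^2$-vector field on $\mathbb{S}^1$ is tangential if it is of the form $z\mapsto f(z)\,iz$ with $f$ real-valued. *)

theory Defs
  imports "HOL-Analysis.Analysis"
begin

section \<open>Smooth maps\<close>

text \<open>
  \<open>Ck_on k S f\<close>: all iterated derivatives of \<open>f\<close> up to order \<open>k\<close> exist and are continuous on \<open>S\<close>.
  Derivatives are taken within \<open>S\<close>; below \<open>S\<close> is an open set \<open>U\<close> or a product \<open>{0..<\<epsilon>} \<times> U\<close>,
  where they are unique (one-sided in the time variable at \<open>0\<close>).
\<close>

primrec Ck_on ::
  "nat \<Rightarrow> 'a::real_normed_vector set \<Rightarrow> ('a \<Rightarrow> 'b::real_normed_vector) \<Rightarrow> bool" where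
  "Ck_on 0 S f \<longleftrightarrow> continuous_on S f"
| "Ck_on (Suc k) S f \<longleftrightarrow>
     (\<exists>f'. (\<forall>x\<in>S. (f has_derivative f' x) (at x within S)) \<and> (\<forall>v. Ck_on k S (\<lambda>x. f' x v)))"

definition smooth_on ::
  "'a::real_normed_vector set \<Rightarrow> ('a \<Rightarrow> 'b::real_normed_vector) \<Rightarrow> bool" where
  "smooth_on S f \<longleftrightarrow> (\<forall>k. Ck_on k S f)"


section \<open>The Poincare disk and its Levi-Civita connection\<close>

text \<open>
  Everything is written in the global chart \<open>disc \<subseteq> complex\<close>: tangent vectors are complex numbers,
  vector fields are functions \<open>complex \<Rightarrow> complex\<close> of which only the values on the disk matter, and
  \<open>Basis = {1, \<i>}\<close> consists of the coordinate vectors.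
\<close>

abbreviation disc :: "complex set" where
  "disc \<equiv> ball 0 1"

definition conf :: "complex \<Rightarrow> real" where
  "conf z = 4 / (1 - (norm z)\<^sup>2)\<^sup>2"

definition hyp_metric :: "complex \<Rightarrow> complex \<Rightarrow> complex \<Rightarrow> real" where
  "hyp_metric z v w = conf z * (v \<bullet> w)"

definition ddir :: "(complex \<Rightarrow> 'b::real_normed_vector) \<Rightarrow> complex \<Rightarrow> complex \<Rightarrow> 'b" where
  "ddir F z v = frechet_derivative F (at z) v"

text \<open>
  \<open>christoffel z v w\<close> is the value at \<open>z\<close> of \<open>\<nabla>\<^sub>v w\<close> for constant vector fields \<open>v\<close>, \<open>w\<close>, as given by
  the Koszul formula; the coordinate vectors are orthogonal of squared length \<open>conf z\<close>, so the inverse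
  metric is \<open>1 / conf z\<close> times the identity.
\<close>

definition christoffel :: "complex \<Rightarrow> complex \<Rightarrow> complex \<Rightarrow> complex" where
  "christoffel z v w =
     (\<Sum>e\<in>Basis. ((ddir (\<lambda>x. hyp_metric x w e) z v + ddir (\<lambda>x. hyp_metric x v e) z w
                    - ddir (\<lambda>x. hyp_metric x v w) z e) / (2 * conf z)) *\<^sub>R e)"


section \<open>Covariant tensors\<close>

text \<open>
  A complex-valued covariant tensor field of order \<open>k\<close> is evaluated at a point and at a list of
  \<open>k\<close> tangent vectors.  In the covariant derivative the direction of differentiation comes first;
  its defining formula is evaluated on constant vector fields.
\<close>

type_synonym tensor = "complex \<Rightarrow> complex list \<Rightarrow> complex"

fun cov_deriv :: "tensor \<Rightarrow> tensor" where
  "cov_deriv T z (u # vs) =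
     ddir (\<lambda>x. T x vs) z u - (\<Sum>i<length vs. T z (vs[i := christoffel z u (vs ! i)]))"
| "cov_deriv T z [] = 0"

text \<open>The norm induced by the metric, i.e. with respect to the orthonormal frame \<open>e / sqrt (conf z)\<close>.
  (For \<open>f dz\<^sup>2\<close> this equals \<open>2 |f| / conf\<close>.)\<close>

definition tensor_norm :: "nat \<Rightarrow> tensor \<Rightarrow> complex \<Rightarrow> real" where
  "tensor_norm k T z =
     sqrt (\<Sum>es | set es \<subseteq> Basis \<and> length es = k. (norm (T z es))\<^sup>2 / conf z ^ k)"

definition bounded_tensor :: "nat \<Rightarrow> tensor \<Rightarrow> bool" where
  "bounded_tensor k T \<longleftrightarrow> (\<exists>C. \<forall>z\<in>disc. tensor_norm k T z \<le> C)"

definition quad_diff :: "(complex \<Rightarrow> complex) \<Rightarrow> tensor" where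
  "quad_diff f z vs = f z * (vs ! 0) * (vs ! 1)"


section \<open>Tension field and harmonic vector fields\<close>

text \<open>\<open>pullback_nabla \<phi> W\<close> is the pulled-back connection applied to a vector field \<open>W\<close> along \<open>\<phi>\<close>.\<close>

definition pullback_nabla ::
  "(complex \<Rightarrow> complex) \<Rightarrow> (complex \<Rightarrow> complex) \<Rightarrow> complex \<Rightarrow> complex \<Rightarrow> complex" where
  "pullback_nabla \<phi> W z v = ddir W z v + christoffel (\<phi> z) (ddir \<phi> z v) (W z)"

definition nabla_d :: "(complex \<Rightarrow> complex) \<Rightarrow> complex \<Rightarrow> complex \<Rightarrow> complex \<Rightarrow> complex" where
  "nabla_d \<phi> z v w = pullback_nabla \<phi> (\<lambda>x. ddir \<phi> x w) z v - ddir \<phi> z (christoffel z v w)"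

definition tension :: "(complex \<Rightarrow> complex) \<Rightarrow> complex \<Rightarrow> complex" where
  "tension \<phi> z = (\<Sum>e\<in>Basis. nabla_d \<phi> z e e) /\<^sub>R conf z"

definition harmonic_vf :: "complex set \<Rightarrow> (complex \<Rightarrow> complex) \<Rightarrow> bool" where
  "harmonic_vf U \<xi> \<longleftrightarrow>
     open U \<and> U \<subseteq> disc \<and> smooth_on U \<xi> \<and>
     (\<exists>\<epsilon>>0. \<exists>\<phi>::real \<Rightarrow> complex \<Rightarrow> complex.
        smooth_on ({0..<\<epsilon>} \<times> U) (\<lambda>(t, z). \<phi> t z) \<and>
        (\<forall>t\<in>{0..<\<epsilon>}. \<phi> t ` U \<subseteq> disc) \<and>
        (\<forall>z\<in>U. \<phi> 0 z = z) \<and>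
        (\<forall>z\<in>U. ((\<lambda>t. \<phi> t z) has_vector_derivative \<xi> z) (at 0 within {0..<\<epsilon>})) \<and>
        (\<forall>z\<in>U. ((\<lambda>t. tension (\<phi> t) z) has_vector_derivative 0) (at 0 within {0..<\<epsilon>})))"


section \<open>Lie derivative of the metric\<close>

text \<open>
  For constant vector fields \<open>v\<close>, \<open>w\<close> one has \<open>[\<xi>, v] = - D\<xi> v\<close>, so that
  \<open>(L\<^sub>\<xi> g)(v, w) = \<xi> (g(v, w)) - g([\<xi>, v], w) - g(v, [\<xi>, w])\<close> takes the following form.
\<close>

definition lie_metric :: "(complex \<Rightarrow> complex) \<Rightarrow> complex \<Rightarrow> complex \<Rightarrow> complex \<Rightarrow> real" where
  "lie_metric \<xi> z v w =
     ddir (\<lambda>x. hyp_metric x v w) z (\<xi> z)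
     + hyp_metric z (ddir \<xi> z v) w + hyp_metric z v (ddir \<xi> z w)"

definition metric_trace :: "complex \<Rightarrow> (complex \<Rightarrow> complex \<Rightarrow> real) \<Rightarrow> real" where
  "metric_trace z B = (\<Sum>e\<in>Basis. B e e) / conf z"

definition trace_free :: "complex \<Rightarrow> (complex \<Rightarrow> complex \<Rightarrow> real) \<Rightarrow> complex \<Rightarrow> complex \<Rightarrow> real" where
  "trace_free z B v w = B v w - metric_trace z B / 2 * hyp_metric z v w"

text \<open>\<open>lie20 \<xi> z\<close> is the coefficient \<open>h\<close> at \<open>z\<close> of the (2,0)-part \<open>h dz\<^sup>2\<close>.\<close>

definition lie20 :: "(complex \<Rightarrow> complex) \<Rightarrow> complex \<Rightarrow> complex" where
  "lie20 \<xi> z = (THE h. \<forall>v w. trace_free z (lie_metric \<xi> z) v w = Re (h * v * w))"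

definition killing_vf :: "(complex \<Rightarrow> complex) \<Rightarrow> bool" where
  "killing_vf \<xi> \<longleftrightarrow> smooth_on disc \<xi> \<and> (\<forall>z\<in>disc. \<forall>v w. lie_metric \<xi> z v w = 0)"


section \<open>Boundary values in the square-integrable sense\<close>

text \<open>
  Arc length on the unit circle.  The underlying \<open>\<sigma>\<close>-algebra lives on the circle itself, so
  measurability on the circle does not involve values elsewhere.
\<close>

definition circle_measure :: "complex measure" where
  "circle_measure =
     distr (restrict_space lborel {0..<2 * pi}) (restrict_space borel (sphere 0 1)) cis"

text \<open>\<open>Y\<close> represents the restriction to the circle of the extension of \<open>X\<close> to the closed disk.\<close>

definition has_L2_boundary_value :: "(complex \<Rightarrow> complex) \<Rightarrow> (complex \<Rightarrow> complex) \<Rightarrow> bool" where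
  "has_L2_boundary_value X Y \<longleftrightarrow>
     continuous_on disc X \<and>
     Y \<in> borel_measurable circle_measure \<and>
     integrable circle_measure (\<lambda>z. (norm (Y z))\<^sup>2) \<and>
     ((\<lambda>\<epsilon>. LINT z|circle_measure. (norm (X (of_real (1 - \<epsilon>) * z) - Y z))\<^sup>2) \<longlongrightarrow> 0)
       (at_right (0::real))"

definition tangential :: "(complex \<Rightarrow> complex) \<Rightarrow> bool" where
  "tangential Y \<longleftrightarrow>
     (\<exists>f::complex \<Rightarrow> real. AE z in circle_measure. Y z = of_real (f z) * (\<i> * z))"

definition extends_tangentially :: "(complex \<Rightarrow> complex) \<Rightarrow> bool" where
  "extends_tangentially X \<longleftrightarrow> (\<exists>Y. has_L2_boundary_value X Y \<and> tangential Y)"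

definition tangential_solution :: "(complex \<Rightarrow> complex) \<Rightarrow> (complex \<Rightarrow> complex) \<Rightarrow> bool" where
  "tangential_solution f \<eta> \<longleftrightarrow>
     harmonic_vf disc \<eta> \<and> (\<forall>z\<in>disc. lie20 \<eta> z = f z) \<and> extends_tangentially \<eta>"

end

theory Submission
  imports Defs "HOL-Complex_Analysis.Cauchy_Integral_Formula"
begin

text \<open>
  In the disk chart the (2,0)-part of \<open>L\<^sub>\<xi> g\<close> is \<open>h dz\<^sup>2\<close> with \<open>h = 2 conf cnj (\<partial>\<xi> / \<partial>(cnj z))\<close>, and the
  tension field linearized at the identity is a multiple of the \<open>z\<close>-derivative of \<open>cnj h\<close>; so \<open>\<xi>\<close> is
  harmonic if \<open>h\<close> is holomorphic.  If \<open>G''' = f\<close> then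
  \<open>\<eta> = ((1 - |z|\<^sup>2)\<^sup>2 cnj G'' + 2 z (1 - |z|\<^sup>2) cnj G' + 2 z\<^sup>2 cnj G) / 8 - G / 4\<close>
  has (2,0)-part \<open>f dz\<^sup>2\<close>.  Boundedness of \<open>f dz\<^sup>2\<close> means \<open>f = O((1 - |z|)\<^bsup>-2\<^esup>)\<close>; integrating along
  radii, \<open>G'' = O((1 - |z|)\<^bsup>-1\<^esup>)\<close>, \<open>G' = O((1 - |z|)\<^bsup>-1/2\<^esup>)\<close> and \<open>G\<close> converges uniformly, so that only
  \<open>(z\<^sup>2 cnj G - G) / 4\<close> survives on the circle, and this is tangential.
  Two vector fields with the same (2,0)-part differ by a holomorphic one \<open>X\<close>.  Tangentiality relates the
  Fourier coefficient of index \<open>k + 2\<close> of the boundary value to that of index \<open>-k\<close>, which vanishes for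
  \<open>k > 0\<close>; hence \<open>X = c + i b z - cnj c z\<^sup>2\<close> with \<open>b\<close> real, and these are the Killing fields.
\<close>

section \<open>Smooth maps\<close>

lemma Ck_on_cong:
  assumes "Ck_on k S f" "\<And>x. x \<in> S \<Longrightarrow> f x = g x"
  shows "Ck_on k S g"
proof (cases k)
  case 0
  then show ?thesis using assms by (simp add: continuous_on_cong[OF refl, of S f g])
next
  case (Suc m)
  then obtain f' where f': "\<And>x. x \<in> S \<Longrightarrow> (f has_derivative f' x) (at x within S)"
    "\<And>v. Ck_on m S (\<lambda>x. f' x v)"
    using assms(1) by auto
  have "(g has_derivative f' x) (at x within S)" if "x \<in> S" for x
    using has_derivative_transform[OF that _ f'(1)[OF that]] assms(2) by simp
  then show ?thesis using f'(2) Suc by auto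
qed

lemma Ck_on_SucI:
  assumes "\<And>x. x \<in> S \<Longrightarrow> (f has_derivative f' x) (at x within S)"
    "\<And>v. Ck_on k S (\<lambda>x. f' x v)"
  shows "Ck_on (Suc k) S f"
  using assms by auto

declare Ck_on.simps(2) [simp del]

lemma Ck_on_SucD: "Ck_on (Suc k) S f \<Longrightarrow> Ck_on k S f"
proof (induction k arbitrary: f)
  case 0
  then show ?case
    by (auto simp: Ck_on.simps(2) continuous_on_eq_continuous_within intro: has_derivative_continuous)
next
  case (Suc k)
  then obtain f' where d: "\<And>x. x \<in> S \<Longrightarrow> (f has_derivative f' x) (at x within S)"
    "\<And>v. Ck_on (Suc k) S (\<lambda>x. f' x v)"
    by (auto simp: Ck_on.simps(2))
  then show ?case using Suc.IH by (auto intro!: Ck_on_SucI)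
qed

lemma Ck_on_const: "Ck_on k S (\<lambda>x. c)"
proof (induction k arbitrary: c)
  case (Suc k)
  then show ?case by (auto intro!: Ck_on_SucI[where f' = "\<lambda>x v. 0"])
qed simp

lemma Ck_on_bounded_linear:
  assumes "bounded_linear L" "Ck_on k S f"
  shows "Ck_on k S (\<lambda>x. L (f x))"
  using assms(2)
proof (induction k arbitrary: f)
  case 0
  then show ?case using bounded_linear.continuous_on[OF assms(1)] by auto
next
  case (Suc k)
  then obtain f' where d: "\<And>x. x \<in> S \<Longrightarrow> (f has_derivative f' x) (at x within S)"
    "\<And>v. Ck_on k S (\<lambda>x. f' x v)"
    by (auto simp: Ck_on.simps(2))
  then show ?case
    by (intro Ck_on_SucI[where f' = "\<lambda>x v. L (f' x v)"] Suc.IH bounded_linear.has_derivative[OF assms(1)])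
qed

lemma Ck_on_linear: "bounded_linear L \<Longrightarrow> Ck_on k S L"
proof (cases k)
  case (Suc m)
  then show "bounded_linear L \<Longrightarrow> Ck_on k S L"
    using Ck_on_SucI[where f' = "\<lambda>_. L" and f = L] Ck_on_const bounded_linear_imp_has_derivative by metis
qed (simp add: linear_continuous_on)

lemma Ck_on_add:
  assumes "Ck_on k S f" "Ck_on k S g"
  shows "Ck_on k S (\<lambda>x. f x + g x)"
  using assms
proof (induction k arbitrary: f g)
  case 0
  then show ?case by (auto intro: continuous_intros)
next
  case (Suc k)
  obtain f' where f': "\<And>x. x \<in> S \<Longrightarrow> (f has_derivative f' x) (at x within S)"
    "\<And>v. Ck_on k S (\<lambda>x. f' x v)"
    using Suc.prems(1) by (auto simp: Ck_on.simps(2))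
  obtain g' where g': "\<And>x. x \<in> S \<Longrightarrow> (g has_derivative g' x) (at x within S)"
    "\<And>v. Ck_on k S (\<lambda>x. g' x v)"
    using Suc.prems(2) by (auto simp: Ck_on.simps(2))
  show ?case
    by (intro Ck_on_SucI[where f' = "\<lambda>x v. f' x v + g' x v"] has_derivative_add Suc.IH f' g')
qed

text \<open>Leibniz rule: each summand pairs a derivative with an undifferentiated factor, which
  \<open>Ck_on_SucD\<close> lowers to order \<open>k\<close>. The locale covers multiplication,
  scaling and the inner product at once.\<close>

lemma (in bounded_bilinear) Ck_on:
  assumes "Ck_on k S f" "Ck_on k S g"
  shows "Ck_on k S (\<lambda>x. prod (f x) (g x))"
  using assms
proof (induction k arbitrary: f g)
  case 0
  then show ?case by (auto intro: continuous_on)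
next
  case (Suc k)
  obtain f' where f': "\<And>x. x \<in> S \<Longrightarrow> (f has_derivative f' x) (at x within S)"
    "\<And>v. Ck_on k S (\<lambda>x. f' x v)"
    using Suc.prems(1) by (auto simp: Ck_on.simps(2))
  obtain g' where g': "\<And>x. x \<in> S \<Longrightarrow> (g has_derivative g' x) (at x within S)"
    "\<And>v. Ck_on k S (\<lambda>x. g' x v)"
    using Suc.prems(2) by (auto simp: Ck_on.simps(2))
  have "Ck_on k S (\<lambda>x. prod (f x) (g' x v) + prod (f' x v) (g x))" for v
    by (intro Ck_on_add Suc.IH f' g' Ck_on_SucD[OF Suc.prems(1)] Ck_on_SucD[OF Suc.prems(2)])
  then show ?case
    by (intro Ck_on_SucI[where f' = "\<lambda>x v. prod (f x) (g' x v) + prod (f' x v) (g x)"] FDERIV f' g')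
qed

lemmas Ck_on_mult = bounded_bilinear.Ck_on[OF bounded_bilinear_mult]
lemmas Ck_on_scaleR = bounded_bilinear.Ck_on[OF bounded_bilinear_scaleR]
lemmas Ck_on_inner = bounded_bilinear.Ck_on[OF bounded_bilinear_inner]

text \<open>The derivative \<open>- f' / f^2\<close> contains the inverse again, which has one order
  less to reach and is covered by the induction hypothesis.\<close>

lemma Ck_on_inverse:
  fixes f :: "'a::real_normed_vector \<Rightarrow> real"
  assumes "Ck_on k S f" "\<And>x. x \<in> S \<Longrightarrow> f x \<noteq> 0"
  shows "Ck_on k S (\<lambda>x. inverse (f x))"
  using assms(1)
proof (induction k)
  case 0
  then show ?case using assms(2) by (auto intro: continuous_intros)
next
  case (Suc k)
  then obtain f' where d: "\<And>x. x \<in> S \<Longrightarrow> (f has_derivative f' x) (at x within S)"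
    "\<And>v. Ck_on k S (\<lambda>x. f' x v)"
    by (auto simp: Ck_on.simps(2))
  have inv: "Ck_on k S (\<lambda>x. inverse (f x))"
    using Suc Ck_on_SucD by blast
  have "Ck_on k S (\<lambda>x. - (inverse (f x) * f' x v * inverse (f x)))" for v
    by (rule Ck_on_bounded_linear[OF bounded_linear_minus[OF bounded_linear_ident]])
      (intro Ck_on_mult inv d)
  then show ?case
    using assms(2) d(1)
    by (auto intro!: Ck_on_SucI[where f' = "\<lambda>x v. - (inverse (f x) * f' x v * inverse (f x))"]
        Deriv.has_derivative_inverse)
qed

text \<open>For fixed \<open>v\<close>, the derivative \<open>f' (L x) (L v)\<close> is again a
  function of \<open>L x\<close>, so the induction closes. This serves to view \<open>\<xi>\<close>
  as a function on \<open>{0..<1} \<times> disc\<close>.\<close>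

lemma Ck_on_comp_linear:
  assumes "bounded_linear L" "L ` T \<subseteq> S" "Ck_on k S f"
  shows "Ck_on k T (\<lambda>x. f (L x))"
  using assms(3)
proof (induction k arbitrary: f)
  case 0
  then show ?case
    using continuous_on_compose2[OF _ linear_continuous_on[OF assms(1)] assms(2)] by auto
next
  case (Suc k)
  then obtain f' where d: "\<And>x. x \<in> S \<Longrightarrow> (f has_derivative f' x) (at x within S)"
    "\<And>v. Ck_on k S (\<lambda>x. f' x v)"
    by (auto simp: Ck_on.simps(2))
  have "((\<lambda>x. f (L x)) has_derivative (\<lambda>v. f' (L x) (L v))) (at x within T)" if "x \<in> T" for x
    by (rule has_derivative_in_compose2[where t = S])
       (use that assms d in \<open>auto intro: bounded_linear_imp_has_derivative\<close>)
  then show ?case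
    using Suc.IH[OF d(2)] by (auto intro!: Ck_on_SucI[where f' = "\<lambda>x v. f' (L x) (L v)"])
qed

text \<open>The real derivative is multiplication by \<open>deriv f x\<close>, which is again
  holomorphic in \<open>x\<close>.\<close>

lemma Ck_on_holomorphic:
  assumes "open S" "f holomorphic_on S"
  shows "Ck_on k S f"
  using assms(2)
proof (induction k arbitrary: f)
  case 0
  then show ?case by (auto intro: holomorphic_on_imp_continuous_on)
next
  case (Suc k)
  have "(f has_derivative (\<lambda>v. deriv f x * v)) (at x within S)" if "x \<in> S" for x
    using holomorphic_derivI[OF Suc.prems assms(1) that] has_field_derivative_imp_has_derivative by auto
  moreover have "Ck_on k S (\<lambda>x. deriv f x * v)" for v
    by (intro Ck_on_mult Suc.IH Ck_on_const holomorphic_deriv Suc.prems assms(1))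
  ultimately show ?case by (intro Ck_on_SucI[where f' = "\<lambda>x v. deriv f x * v"])
qed

lemma smooth_on_holomorphic: "open S \<Longrightarrow> f holomorphic_on S \<Longrightarrow> smooth_on S f"
  by (simp add: smooth_on_def Ck_on_holomorphic)

lemma smooth_on_differentiable:
  assumes "smooth_on S f" "open S" "x \<in> S"
  shows "f differentiable (at x)"
proof -
  have "Ck_on (Suc 0) S f" using assms(1) unfolding smooth_on_def by blast
  then obtain f' where "(f has_derivative f' x) (at x within S)" using assms(3) by (auto simp: Ck_on.simps(2))
  then show ?thesis using assms unfolding differentiable_def by (metis at_within_open)
qed

section \<open>The hyperbolic metric in the disk chart\<close>

lemma ddir_eq: "(F has_derivative F') (at z) \<Longrightarrow> ddir F z v = F' v"
  unfolding ddir_def by (metis frechet_derivative_at)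

lemma ddir_complex:
  fixes F :: "complex \<Rightarrow> complex"
  assumes "F differentiable (at z)"
  shows "ddir F z v = of_real (Re v) * ddir F z 1 + of_real (Im v) * ddir F z \<i>"
proof -
  have lin: "linear (ddir F z)"
    using linear_frechet_derivative[OF assms] by (simp add: ddir_def[abs_def])
  have "v = Re v *\<^sub>R 1 + Im v *\<^sub>R \<i>" by (simp add: complex_eq_iff)
  then have "ddir F z v = Re v *\<^sub>R ddir F z 1 + Im v *\<^sub>R ddir F z \<i>"
    by (metis lin linear_add linear_scale)
  then show ?thesis by (simp add: scaleR_conv_of_real)
qed

lemma norm_disc: "z \<in> disc \<Longrightarrow> 0 < 1 - (norm z)\<^sup>2"
  by (simp add: abs_square_less_1)

lemma conf_pos: "z \<in> disc \<Longrightarrow> 0 < conf z"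
  using norm_disc[of z] by (simp add: conf_def)

lemma ddir_hyp_metric:
  assumes "z \<in> disc"
  shows "ddir (\<lambda>x. hyp_metric x v w) z u
    = conf z * (4 * (z \<bullet> u) / (1 - (norm z)\<^sup>2)) * (v \<bullet> w)"
proof -
  define s where "s = 1 - (norm z)\<^sup>2"
  have s: "s \<noteq> 0" using norm_disc[OF assms] by (simp add: s_def)
  have "((\<lambda>x. 1 - x \<bullet> x) has_derivative (\<lambda>u. - (2 * (z \<bullet> u)))) (at z)"
    by (auto intro!: derivative_eq_intros simp: inner_commute)
  from has_derivative_power[OF this, of 2]
  have "((\<lambda>x. (1 - x \<bullet> x)\<^sup>2) has_derivative (\<lambda>u. - (4 * (z \<bullet> u) * s))) (at z)"
    by (simp add: s_def power2_norm_eq_inner algebra_simps)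
  from has_derivative_mult_left[OF has_derivative_mult_right[OF Deriv.has_derivative_inverse[OF _ this]], of 4 "v \<bullet> w"]
  have "((\<lambda>x. hyp_metric x v w) has_derivative
      (\<lambda>u. 4 * (4 * (z \<bullet> u) * s / s ^ 4) * (v \<bullet> w))) (at z)"
    using s by (simp add: hyp_metric_def[abs_def] conf_def s_def power2_norm_eq_inner divide_inverse
        mult_ac power_inverse flip: power_mult power_mult_distrib power_add) (simp add: eval_nat_numeral mult_ac)
  then show ?thesis
    using s by (simp add: ddir_eq conf_def flip: s_def) (simp add: field_simps eval_nat_numeral)
qed

text \<open>The metric is exp(2 u) times the Euclidean one with u = log (2 / (1 - |z|^2)), and the
  Christoffel term of such a metric is 2 u_z v w. Its complex bilinearity drives the cancellations
  in the tension field.\<close>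

lemma christoffel_eq:
  assumes "z \<in> disc"
  shows "christoffel z v w = 2 * cnj z * v * w / of_real (1 - (norm z)\<^sup>2)"
proof -
  define s where "s = 1 - (norm z)\<^sup>2"
  have s: "s \<noteq> 0" "conf z \<noteq> 0" using norm_disc[OF assms] conf_pos[OF assms] by (simp_all add: s_def)
  have "christoffel z v w
    = (\<Sum>e\<in>Basis. (2 / s * ((z \<bullet> v) * (w \<bullet> e) + (z \<bullet> w) * (v \<bullet> e) - (z \<bullet> e) * (v \<bullet> w))) *\<^sub>R e)"
    unfolding christoffel_def
    by (rule sum.cong) (use s in \<open>simp_all add: ddir_hyp_metric[OF assms] flip: s_def\<close>,
        simp add: field_simps)
  also have "\<dots> = 2 * cnj z * v * w / of_real s"
    by (simp add: Basis_complex_def complex_eq_iff inner_complex_def field_simps s)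
  finally show ?thesis by (simp add: s_def)
qed

text \<open>Split the real differential of \<open>\<xi>\<close> into its complex linear and
  antilinear parts. The antilinear part,
  \<open>(ddir \<xi> z 1 + \<i> * ddir \<xi> z \<i>) / 2\<close>, yields the trace-free summand; the
  real part of the linear one and the derivative of \<open>conf\<close> yield a multiple of the
  metric.\<close>

lemma lie_metric_eq:
  assumes z: "z \<in> disc" and \<xi>: "\<xi> differentiable (at z)"
  shows "lie_metric \<xi> z v w =
    Re (of_real (conf z) * cnj (ddir \<xi> z 1 + \<i> * ddir \<xi> z \<i>) * v * w)
    + (4 * (z \<bullet> \<xi> z) / (1 - (norm z)\<^sup>2) + Re (ddir \<xi> z 1) + Im (ddir \<xi> z \<i>)) * hyp_metric z v w"
  unfolding lie_metric_def ddir_hyp_metric[OF z]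
  unfolding ddir_complex[OF \<xi>, of v] ddir_complex[OF \<xi>, of w]
  unfolding hyp_metric_def
  by (simp add: inner_complex_def algebra_simps)

lemma lie20_eq:
  assumes z: "z \<in> disc" and \<xi>: "\<xi> differentiable (at z)"
  shows "lie20 \<xi> z = of_real (conf z) * cnj (ddir \<xi> z 1 + \<i> * ddir \<xi> z \<i>)"
    (is "_ = ?h")
proof -
  define m where "m = 4 * (z \<bullet> \<xi> z) / (1 - (norm z)\<^sup>2) + Re (ddir \<xi> z 1) + Im (ddir \<xi> z \<i>)"
  have lie: "lie_metric \<xi> z v w = Re (?h * v * w) + m * hyp_metric z v w" for v w
    using lie_metric_eq[OF assms] by (simp add: m_def)
  have "metric_trace z (lie_metric \<xi> z) = 2 * m"
    using conf_pos[OF z] unfolding metric_trace_def lie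
    by (simp add: Basis_complex_def hyp_metric_def inner_complex_def field_simps)
  then have tf: "trace_free z (lie_metric \<xi> z) v w = Re (?h * v * w)" for v w
    by (simp add: trace_free_def lie)
  show ?thesis
    unfolding lie20_def tf
  proof (rule the_equality)
    fix h assume "\<forall>v w. Re (?h * v * w) = Re (h * v * w)"
    \<comment> \<open>These two pairs read off Re h and - Im h.\<close>
    from this[rule_format, of 1 1] this[rule_format, of 1 \<i>] show "h = ?h"
      by (simp add: complex_eq_iff)
  qed simp
qed

section \<open>A sufficient condition for harmonicity\<close>

text \<open>Joint smoothness gives derivatives within a product, one-sided in time at 0, while
  \<open>tension\<close> differentiates in space at a frozen time. Openness of \<open>U\<close>
  turns the slice derivative into an unrestricted one.\<close>

lemma has_derivative_slice:
  assumes "(F has_derivative F') (at (t, z) within T \<times> U)" "t \<in> T" "open U" "z \<in> U"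
  shows "((\<lambda>x. F (t, x)) has_derivative (\<lambda>v. F' (0, v))) (at z)"
proof -
  have "((\<lambda>x. (t, x)) has_derivative (\<lambda>v. (0, v))) (at z within U)"
    by (auto intro!: derivative_eq_intros)
  moreover have "(F has_derivative F') (at (t, z) within (\<lambda>x. (t, x)) ` U)"
    by (rule has_derivative_subset[OF assms(1)]) (use assms(2) in auto)
  ultimately have "((\<lambda>x. F (t, x)) has_derivative (\<lambda>v. F' (0, v))) (at z within U)"
    by (rule has_derivative_in_compose)
  then show ?thesis using assms by (metis at_within_open)
qed

text \<open>The difference quotient of \<open>f\<close> at 0 is exactly \<open>g t\<close>, so
  continuity of \<open>g\<close> at 0 replaces a differentiation in \<open>t\<close>.\<close>

lemma has_vector_derivative_at_0I:
  assumes "(g \<longlongrightarrow> g0) (at 0 within S)" "\<And>t. t \<in> S \<Longrightarrow> f t = f0 + t *\<^sub>R g t" "0 \<in> S"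
  shows "(f has_vector_derivative g0) (at 0 within S)"
proof -
  have f0: "f 0 = f0" using assms by simp
  have "((\<lambda>t. norm (g t - g0)) \<longlongrightarrow> 0) (at 0 within S)"
    using assms(1) tendsto_norm_zero LIM_zero by blast
  moreover have "norm ((1 / norm (t - 0)) *\<^sub>R (f t - (f 0 + (t - 0) *\<^sub>R g0))) = norm (g t - g0)"
    if "t \<in> S" "t \<noteq> 0" for t
    using that by (simp add: assms(2) f0 flip: scaleR_diff_right)
  then have "\<forall>\<^sub>F t in at 0 within S.
      norm (g t - g0) = norm ((1 / norm (t - 0)) *\<^sub>R (f t - (f 0 + (t - 0) *\<^sub>R g0)))"
    unfolding eventually_at_filter by (intro always_eventually) simp
  ultimately have "((\<lambda>t. norm ((1 / norm (t - 0)) *\<^sub>R (f t - (f 0 + (t - 0) *\<^sub>R g0)))) \<longlongrightarrow> 0) (at 0 within S)"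
    by (rule Lim_transform_eventually)
  then show ?thesis
    unfolding has_vector_derivative_def has_derivative_within
    by (auto intro: tendsto_norm_zero_cancel bounded_linear_scaleR_left)
qed

text \<open>With \<open>\<phi> = id + t N\<close> the tension field is divisible by \<open>t\<close>; the quotient at \<open>t = 0\<close> is its
  linearization at the identity.\<close>

lemma tension_perturbation:
  fixes N :: "complex \<Rightarrow> complex"
  assumes N: "\<And>x. x \<in> disc \<Longrightarrow> (N has_derivative N' x) (at x)"
    and N': "\<And>e. ((\<lambda>x. N' x e) has_derivative N'' e) (at z)"
    and z: "z \<in> disc" and \<phi>z: "z + of_real t * N z \<in> disc"
  shows "tension (\<lambda>x. x + of_real t * N x) z = t *\<^sub>R ((N'' 1 1 + N'' \<i> \<i>
    + 2 * cnj (z + of_real t * N z) / of_real (1 - (norm (z + of_real t * N z))\<^sup>2)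
      * (2 * (N' z 1 + \<i> * N' z \<i>) + of_real t * ((N' z 1)\<^sup>2 + (N' z \<i>)\<^sup>2))) /\<^sub>R conf z)"
proof -
  define \<phi> where "\<phi> = (\<lambda>x. x + of_real t * N x)"
  define c where "c = 2 * cnj (\<phi> z) / of_real (1 - (norm (\<phi> z))\<^sup>2)"
  have \<phi>: "(\<phi> has_derivative (\<lambda>v. v + of_real t * N' x v)) (at x)" if "x \<in> disc" for x
    unfolding \<phi>_def by (intro derivative_intros N that)
  have d1: "ddir \<phi> x v = v + of_real t * N' x v" if "x \<in> disc" for x v
    using ddir_eq[OF \<phi>[OF that]] .
  have "((\<lambda>x. ddir \<phi> x e) has_derivative (\<lambda>v. of_real t * N'' e v)) (at z)" for e
  proof (rule has_derivative_transform_within_open[where s = disc])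
    show "((\<lambda>x. e + of_real t * N' x e) has_derivative (\<lambda>v. of_real t * N'' e v)) (at z)"
      by (auto intro!: derivative_eq_intros N')
  qed (use z d1 in auto)
  then have d2: "ddir (\<lambda>x. ddir \<phi> x e) z v = of_real t * N'' e v" for e v
    by (rule ddir_eq)
  have chr: "christoffel (\<phi> z) v w = c * v * w" for v w
    using christoffel_eq[of "\<phi> z"] \<phi>z by (simp add: c_def \<phi>_def)
  \<comment> \<open>By complex bilinearity, so the terms in which \<open>\<phi>\<close> is
    differentiated along the domain connection cancel in the trace.\<close>
  have "christoffel z \<i> \<i> = - christoffel z 1 1"
    by (simp add: christoffel_eq[OF z] mult.assoc)
  then have "ddir \<phi> z (christoffel z \<i> \<i>) = - ddir \<phi> z (christoffel z 1 1)"
    using linear_neg[OF has_derivative_linear[OF \<phi>[OF z]]] d1[OF z] by simp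
  then have "tension \<phi> z = (of_real t * N'' 1 1 + c * (1 + of_real t * N' z 1)\<^sup>2
      + (of_real t * N'' \<i> \<i> + c * (\<i> + of_real t * N' z \<i>)\<^sup>2)) /\<^sub>R conf z"
    unfolding tension_def nabla_d_def pullback_nabla_def d2 chr d1[OF z, of 1] d1[OF z, of \<i>]
    by (simp add: Basis_complex_def d1[OF z] power2_eq_square algebra_simps)
  \<comment> \<open>The terms of order 0 in \<open>t\<close> add up to c (1 + i^2) = 0, which lets a
    factor \<open>t\<close> come out.\<close>
  also have "of_real t * N'' 1 1 + c * (1 + of_real t * N' z 1)\<^sup>2
      + (of_real t * N'' \<i> \<i> + c * (\<i> + of_real t * N' z \<i>)\<^sup>2)
    = t *\<^sub>R (N'' 1 1 + N'' \<i> \<i> + c * (2 * (N' z 1 + \<i> * N' z \<i>)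
      + of_real t * ((N' z 1)\<^sup>2 + (N' z \<i>)\<^sup>2)))"
    by (simp add: scaleR_conv_of_real power2_eq_square algebra_simps)
  finally show ?thesis by (simp add: c_def \<phi>_def mult_ac)
qed

text \<open>The left side of \<open>eq\<close> is the linearized tension field multiplied by
  \<open>conf z\<close>. The deformation is z + t N(t, z) with N(0, z) = \<open>\<xi> z\<close>;
  \<open>tension_perturbation\<close> makes its tension \<open>t\<close> times a quotient that is
  continuous at t = 0 and vanishes there by \<open>eq\<close>.\<close>

lemma harmonic_vfI:
  assumes \<xi>: "smooth_on disc \<xi>"
    and eq: "\<And>z. z \<in> disc \<Longrightarrow> ddir (\<lambda>x. ddir \<xi> x 1) z 1 + ddir (\<lambda>x. ddir \<xi> x \<i>) z \<i>
      + 4 * cnj z / of_real (1 - (norm z)\<^sup>2) * (ddir \<xi> z 1 + \<i> * ddir \<xi> z \<i>) = 0"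
  shows "harmonic_vf disc \<xi>"
proof -
  define S where "S = {0..<1::real} \<times> disc"
  \<comment> \<open>Damping \<open>\<xi>\<close> keeps \<open>z + t N (t, z)\<close> in the disk for all \<open>z\<close> at once, although \<open>\<xi>\<close> may be unbounded.\<close>
  define N where "N = (\<lambda>p. inverse (1 + fst p * fst p *
    ((\<xi> (snd p) \<bullet> \<xi> (snd p)) * (inverse (1 - snd p \<bullet> snd p) * inverse (1 - snd p \<bullet> snd p)))) *\<^sub>R \<xi> (snd p))"
  have N: "Ck_on k S N" for k
  proof -
    have fst: "Ck_on k S fst" and snd: "Ck_on k S snd"
      by (intro Ck_on_linear bounded_linear_fst bounded_linear_snd)+
    have \<xi>': "Ck_on k S (\<lambda>p. \<xi> (snd p))"
      using \<xi> by (intro Ck_on_comp_linear[OF bounded_linear_snd, of _ disc]) (auto simp: S_def smooth_on_def)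
    have "Ck_on k S (\<lambda>p. 1 + - (snd p \<bullet> snd p))"
      by (intro Ck_on_add Ck_on_const Ck_on_bounded_linear[OF bounded_linear_minus[OF bounded_linear_ident]]
          Ck_on_inner snd)
    then have inv: "Ck_on k S (\<lambda>p. inverse (1 - snd p \<bullet> snd p))"
      using norm_disc by (intro Ck_on_inverse) (fastforce simp: S_def power2_norm_eq_inner)+
    have "1 + fst p * fst p *
      ((\<xi> (snd p) \<bullet> \<xi> (snd p)) * (inverse (1 - snd p \<bullet> snd p) * inverse (1 - snd p \<bullet> snd p))) \<noteq> 0" for p
      by (smt (verit) inner_ge_zero mult_nonneg_nonneg zero_le_square)
    then show ?thesis
      unfolding N_def
      by (intro Ck_on_scaleR Ck_on_inverse Ck_on_add Ck_on_const Ck_on_mult Ck_on_inner fst \<xi>' inv)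
  qed
  have N0: "N (0, z) = \<xi> z" for z by (simp add: N_def)
  \<comment> \<open>The tension involves spatial derivatives up to order two; their joint continuity
    allows passing to t = 0.\<close>
  have "Ck_on (Suc (Suc 0)) S N" by (rule N)
  then obtain N' where N': "\<And>p. p \<in> S \<Longrightarrow> (N has_derivative N' p) (at p within S)"
    and CN': "\<And>v. Ck_on (Suc 0) S (\<lambda>p. N' p v)"
    unfolding Ck_on.simps(2)[of "Suc 0"] by auto
  then have "\<forall>v. \<exists>N''. (\<forall>p\<in>S. ((\<lambda>p. N' p v) has_derivative N'' p) (at p within S)) \<and>
      (\<forall>u. continuous_on S (\<lambda>p. N'' p u))"
    by (simp add: Ck_on.simps(2))
  then obtain N'' where N'': "\<And>v p. p \<in> S \<Longrightarrow> ((\<lambda>p. N' p v) has_derivative N'' v p) (at p within S)"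
    and cN'': "\<And>v u. continuous_on S (\<lambda>p. N'' v p u)"
    by metis
  have cN: "continuous_on S N" using N[of 0] by simp
  have cN': "continuous_on S (\<lambda>p. N' p v)" for v using Ck_on_SucD[OF CN', of v] by simp
  have slice: "((\<lambda>t. h (t, z)) \<longlongrightarrow> h (0, z)) (at 0 within {0..<1})"
    if "continuous_on S h" "z \<in> disc" for h :: "_ \<Rightarrow> complex" and z
  proof -
    have "continuous_on {0..<1} (\<lambda>t. h (t, z))"
      by (rule continuous_on_compose2[OF that(1)]) (use that(2) in \<open>auto simp: S_def intro!: continuous_intros\<close>)
    then show ?thesis by (auto simp: continuous_on_def)
  qed
  have d1: "((\<lambda>x. N (t, x)) has_derivative (\<lambda>v. N' (t, x) (0, v))) (at x)"
    if "t \<in> {0..<1}" "x \<in> disc" for t x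
    using has_derivative_slice[OF N'[unfolded S_def]] that by auto
  have d2: "((\<lambda>x. N' (t, x) (0, e)) has_derivative (\<lambda>v. N'' (0, e) (t, x) (0, v))) (at x)"
    if "t \<in> {0..<1}" "x \<in> disc" for t x e
    using has_derivative_slice[OF N''[unfolded S_def]] that by auto
  define \<phi> where "\<phi> = (\<lambda>t z. z + of_real t * N (t, z))"
  have \<phi>_disc: "\<phi> t z \<in> disc" if "z \<in> disc" for t z
  proof -
    define s where "s = 1 - (norm z)\<^sup>2"
    have s: "s > 0" using norm_disc[OF that] by (simp add: s_def)
    \<comment> \<open>In terms of \<open>a\<close> the damping factor of \<open>N\<close> is 1 / (1
      + a^2). From 2 a \<le> 1 + a^2 the displacement is at most s / 2 = (1 - |z|) (1 + |z|) / 2,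
      which is less than the distance 1 - |z| to the circle.\<close>
    define a where "a = \<bar>t\<bar> * norm (\<xi> z) / s"
    have "norm (of_real t * N (t, z)) = \<bar>t\<bar> * norm (\<xi> z) / (1 + a\<^sup>2)"
      by (simp add: N_def norm_mult a_def s_def divide_inverse power_mult_distrib power_inverse
          flip: power2_norm_eq_inner power2_eq_square)
    also have "\<dots> = a * s / (1 + a\<^sup>2)" using s by (simp add: a_def)
    also have "\<dots> \<le> s / 2"
    proof -
      have "2 * a \<le> 1 + a\<^sup>2" using sum_squares_bound[of 1 a] by simp
      then have "2 * a * s \<le> (1 + a\<^sup>2) * s" using s by (simp add: mult_right_mono)
      moreover have "1 + a\<^sup>2 > 0" by (smt (verit) zero_le_power2)
      ultimately show ?thesis by (simp add: field_simps)
    qed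
    also have "s = (1 - norm z) * (1 + norm z)"
      by (simp add: s_def power2_eq_square algebra_simps)
    also have "\<dots> / 2 < 1 - norm z"
    proof -
      have "(1 - norm z) * (1 + norm z) < (1 - norm z) * 2"
        using that by (intro mult_strict_left_mono) auto
      then show ?thesis by simp
    qed
    finally show ?thesis
      using norm_triangle_ineq[of z "of_real t * N (t, z)"] by (simp add: \<phi>_def)
  qed
  have "smooth_on S (\<lambda>(t, z). \<phi> t z)"
    unfolding smooth_on_def
  proof
    fix k
    have "Ck_on k S (\<lambda>p. snd p + fst p *\<^sub>R N p)"
      by (intro Ck_on_add Ck_on_scaleR N Ck_on_linear bounded_linear_fst bounded_linear_snd)
    then show "Ck_on k S (\<lambda>(t, z). \<phi> t z)"
      by (rule Ck_on_cong) (auto simp: \<phi>_def scaleR_conv_of_real)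
  qed
  moreover have "((\<lambda>t. \<phi> t z) has_vector_derivative \<xi> z) (at 0 within {0..<1})" if "z \<in> disc" for z
    using has_vector_derivative_at_0I[OF slice[OF cN that, unfolded N0], of "\<lambda>t. \<phi> t z" z]
    by (simp add: \<phi>_def scaleR_conv_of_real)
  moreover have "((\<lambda>t. tension (\<phi> t) z) has_vector_derivative 0) (at 0 within {0..<1})"
    if z: "z \<in> disc" for z
  proof -
    \<comment> \<open>The quotient from \<open>tension_perturbation\<close> for the field N(t, .);
      its value at 0 is the left side of \<open>eq\<close> divided by \<open>conf z\<close>.\<close>
    define g where "g = (\<lambda>t. (N'' (0, 1) (t, z) (0, 1) + N'' (0, \<i>) (t, z) (0, \<i>)
      + 2 * cnj (z + of_real t * N (t, z)) / of_real (1 - (norm (z + of_real t * N (t, z)))\<^sup>2)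
        * (2 * (N' (t, z) (0, 1) + \<i> * N' (t, z) (0, \<i>))
          + of_real t * ((N' (t, z) (0, 1))\<^sup>2 + (N' (t, z) (0, \<i>))\<^sup>2))) /\<^sub>R conf z)"
    have lim: "(g \<longlongrightarrow> g 0) (at 0 within {0..<1})"
      unfolding g_def
      by (intro tendsto_intros slice[OF cN z] slice[OF cN' z] slice[OF cN'' z])
        (use norm_disc[OF z] in \<open>simp del: of_real_diff of_real_power\<close>)
    have e1: "ddir \<xi> x e = N' (0, x) (0, e)" if "x \<in> disc" for x e
      using ddir_eq[OF d1[OF _ that, of 0]] by (simp add: N0)
    have "((\<lambda>x. ddir \<xi> x e) has_derivative (\<lambda>v. N'' (0, e) (0, z) (0, v))) (at z)" for e
      by (rule has_derivative_transform_within_open[OF d2[OF _ z, of 0 e], where s = disc])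
        (use z e1 in auto)
    then have e2: "ddir (\<lambda>x. ddir \<xi> x e) z v = N'' (0, e) (0, z) (0, v)" for e v
      by (rule ddir_eq)
    have "g 0 = (ddir (\<lambda>x. ddir \<xi> x 1) z 1 + ddir (\<lambda>x. ddir \<xi> x \<i>) z \<i>
        + 4 * cnj z / of_real (1 - (norm z)\<^sup>2) * (ddir \<xi> z 1 + \<i> * ddir \<xi> z \<i>)) /\<^sub>R conf z"
      by (simp add: g_def e1[OF z] e2 N0 algebra_simps add_divide_distrib)
    then have "g 0 = 0" unfolding eq[OF z] by simp
    moreover have "tension (\<phi> t) z = 0 + t *\<^sub>R g t" if "t \<in> {0..<1}" for t
      unfolding \<phi>_def g_def
      using tension_perturbation[OF d1[OF that] d2[OF that z] z] \<phi>_disc[OF z, of t]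
      by (simp add: \<phi>_def)
    ultimately show ?thesis
      using has_vector_derivative_at_0I[OF lim] by force
  qed
  ultimately show ?thesis
    unfolding harmonic_vf_def S_def
    using \<xi> \<phi>_disc by (intro conjI exI[of _ 1] exI[of _ \<phi>]) (auto simp: \<phi>_def)
qed

section \<open>Vector fields with prescribed (2,0)-part\<close>

lemma smooth_on_disc_has_derivative:
  assumes "smooth_on disc \<xi>" "z \<in> disc"
  shows "(\<xi> has_derivative ddir \<xi> z) (at z)"
  using smooth_on_differentiable[OF assms(1) open_ball assms(2)]
  by (simp add: frechet_derivative_works ddir_def[abs_def])

lemma ddir_holomorphic:
  assumes "h holomorphic_on disc" "z \<in> disc"
  shows "ddir h z v = deriv h z * v"
  using holomorphic_derivI[OF assms(1) open_ball assms(2)]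
  by (intro ddir_eq) (simp add: has_field_derivative_def)

lemma holomorphic_on_disc_CR:
  assumes \<xi>: "\<And>z. z \<in> disc \<Longrightarrow> (\<xi> has_derivative ddir \<xi> z) (at z)"
    and CR: "\<And>z. z \<in> disc \<Longrightarrow> ddir \<xi> z 1 + \<i> * ddir \<xi> z \<i> = 0"
  shows "\<xi> holomorphic_on disc"
proof -
  have "(\<xi> has_field_derivative ddir \<xi> z 1) (at z)" if z: "z \<in> disc" for z
  proof -
    have "\<i> * (ddir \<xi> z 1 + \<i> * ddir \<xi> z \<i>) = 0" using CR[OF z] by simp
    then have i: "ddir \<xi> z \<i> = \<i> * ddir \<xi> z 1" by (simp add: algebra_simps)
    have "ddir \<xi> z v = ddir \<xi> z 1 * v" for v
    proof -
      have "ddir \<xi> z v = of_real (Re v) * ddir \<xi> z 1 + of_real (Im v) * ddir \<xi> z \<i>"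
        using \<xi>[OF z] by (intro ddir_complex) (auto simp: differentiable_def)
      also have "\<dots> = ddir \<xi> z 1 * (of_real (Re v) + \<i> * of_real (Im v))"
        unfolding i by (simp add: algebra_simps)
      finally show ?thesis by (simp flip: complex_eq)
    qed
    then have "ddir \<xi> z = (*) (ddir \<xi> z 1)" by (rule ext)
    then show ?thesis
      using \<xi>[OF z] unfolding has_field_derivative_def by metis
  qed
  then show ?thesis
    using holomorphic_on_open by blast
qed

text \<open>By \<open>lie20_eq\<close> the (2,0)-part determines the antiholomorphic derivative,
  because \<open>conf\<close> is nonzero. The difference therefore satisfies the Cauchy-Riemann
  equations.\<close>

lemma lie20_eq_imp_diff_holomorphic:
  assumes "smooth_on disc \<xi>" "smooth_on disc \<eta>" "\<And>z. z \<in> disc \<Longrightarrow> lie20 \<xi> z = lie20 \<eta> z"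
  shows "(\<lambda>z. \<xi> z - \<eta> z) holomorphic_on disc"
proof -
  have d: "((\<lambda>z. \<xi> z - \<eta> z) has_derivative (\<lambda>v. ddir \<xi> z v - ddir \<eta> z v)) (at z)" if "z \<in> disc" for z
    by (intro has_derivative_diff smooth_on_disc_has_derivative assms that)
  then have dd: "ddir (\<lambda>z. \<xi> z - \<eta> z) z = (\<lambda>v. ddir \<xi> z v - ddir \<eta> z v)" if "z \<in> disc" for z
    using ddir_eq that by blast
  show ?thesis
  proof (rule holomorphic_on_disc_CR)
    fix z assume z: "z \<in> disc"
    have "\<xi> differentiable (at z)" "\<eta> differentiable (at z)"
      using assms z by (auto intro: smooth_on_differentiable)
    then have "ddir \<xi> z 1 + \<i> * ddir \<xi> z \<i> = ddir \<eta> z 1 + \<i> * ddir \<eta> z \<i>"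
      using assms(3)[OF z] conf_pos[OF z] z by (simp add: lie20_eq del: complex_cnj_add complex_cnj_mult)
    then show "ddir (\<lambda>z. \<xi> z - \<eta> z) z 1 + \<i> * ddir (\<lambda>z. \<xi> z - \<eta> z) z \<i> = 0"
      by (simp add: dd[OF z] algebra_simps)
  qed (use d dd in simp)
qed

text \<open>\<open>A - 2 \<zeta> B + \<zeta>\<^sup>2 C\<close> is a primitive in \<open>z\<close> of \<open>(1 - \<zeta> z)\<^sup>2 f / 8\<close>, for \<open>\<zeta> = cnj z\<close>;
  so \<open>\<eta>\<close> solves \<open>conf z * 2 * \<partial>\<eta> / \<partial>(cnj z) = cnj f\<close>.\<close>

lemma prescribed_lie20:
  assumes f: "f holomorphic_on disc"
    and A: "\<And>z. z \<in> disc \<Longrightarrow> (A has_field_derivative f z / 8) (at z)"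
    and B: "\<And>z. z \<in> disc \<Longrightarrow> (B has_field_derivative z * f z / 8) (at z)"
    and C: "\<And>z. z \<in> disc \<Longrightarrow> (C has_field_derivative z\<^sup>2 * f z / 8) (at z)"
    and h: "h holomorphic_on disc"
    and \<eta>: "\<And>z. z \<in> disc \<Longrightarrow> \<eta> z = cnj (A z) - 2 * z * cnj (B z) + z\<^sup>2 * cnj (C z) + h z"
  shows "harmonic_vf disc \<eta>" "\<And>z. z \<in> disc \<Longrightarrow> lie20 \<eta> z = f z"
proof -
  \<comment> \<open>\<open>D\<close> and \<open>E\<close> are the derivatives of
    \<open>\<eta>\<close> with respect to z and cnj z. In \<open>E\<close> the contributions of
    \<open>A\<close>, \<open>B\<close> and \<open>C\<close> combine into a perfect square.\<close>
  define D where "D = (\<lambda>z. - 2 * cnj (B z) + 2 * z * cnj (C z) + deriv h z)"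
  define E where "E = (\<lambda>z. cnj (f z) * (1 - z * cnj z)\<^sup>2 / 8)"
  have hol: "A holomorphic_on disc" "B holomorphic_on disc" "C holomorphic_on disc"
    using A B C holomorphic_on_open[of disc] by blast+
  have smooth: "smooth_on disc \<eta>"
    unfolding smooth_on_def
  proof
    fix k
    have "Ck_on k disc (\<lambda>z. cnj (A z) + (- 2 * z) * cnj (B z) + z\<^sup>2 * cnj (C z) + h z)"
      by (intro Ck_on_add Ck_on_mult Ck_on_bounded_linear[OF bounded_linear_cnj]
          Ck_on_holomorphic hol h open_ball holomorphic_intros)
    then show "Ck_on k disc \<eta>"
      by (rule Ck_on_cong) (simp add: \<eta>)
  qed
  have d1: "(\<eta> has_derivative (\<lambda>v. D z * v + E z * cnj v)) (at z)" if z: "z \<in> disc" for z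
  proof (rule has_derivative_transform_within_open[where s = disc])
    have "((\<lambda>z. cnj (A z) - 2 * z * cnj (B z) + z\<^sup>2 * cnj (C z) + h z) has_derivative
      (\<lambda>v. cnj (f z / 8 * v) - (2 * z * cnj (z * f z / 8 * v) + 2 * v * cnj (B z))
        + (z\<^sup>2 * cnj (z\<^sup>2 * f z / 8 * v) + 2 * z * v * cnj (C z)) + deriv h z * v)) (at z)"
      using z
      by (auto intro!: derivative_eq_intros A[THEN has_field_derivative_imp_has_derivative]
          B[THEN has_field_derivative_imp_has_derivative] C[THEN has_field_derivative_imp_has_derivative]
          holomorphic_derivI[OF h, THEN has_field_derivative_imp_has_derivative])
    moreover have "(\<lambda>v. cnj (f z / 8 * v) - (2 * z * cnj (z * f z / 8 * v) + 2 * v * cnj (B z))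
        + (z\<^sup>2 * cnj (z\<^sup>2 * f z / 8 * v) + 2 * z * v * cnj (C z)) + deriv h z * v)
      = (\<lambda>v. D z * v + E z * cnj v)"
      by (simp add: fun_eq_iff D_def E_def power2_eq_square field_simps)
    ultimately show "((\<lambda>z. cnj (A z) - 2 * z * cnj (B z) + z\<^sup>2 * cnj (C z) + h z) has_derivative
      (\<lambda>v. D z * v + E z * cnj v)) (at z)" by simp
  qed (use z \<eta> in auto)
  have e1: "ddir \<eta> z v = D z * v + E z * cnj v" if "z \<in> disc" for z v
    using ddir_eq[OF d1[OF that]] .
  show lie: "lie20 \<eta> z = f z" if z: "z \<in> disc" for z
  proof -
    have "\<eta> differentiable (at z)" using d1[OF z] by (auto simp: differentiable_def)
    then have "lie20 \<eta> z = of_real (conf z) * (f z * (1 - cnj z * z)\<^sup>2 / 4)"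
      by (simp add: lie20_eq[OF z] e1[OF z] E_def algebra_simps)
    also have "1 - cnj z * z = of_real (1 - (norm z)\<^sup>2)"
      by (simp add: complex_norm_square mult.commute del: of_real_power)
    also have "of_real (conf z) * (f z * (of_real (1 - (norm z)\<^sup>2))\<^sup>2 / 4) = f z"
      using norm_disc[OF z] by (simp add: conf_def del: of_real_diff of_real_power flip: of_real_power)
    finally show ?thesis .
  qed
  show "harmonic_vf disc \<eta>"
  proof (rule harmonic_vfI[OF smooth])
    fix z assume z: "z \<in> disc"
    define s where "s = 1 - z * cnj z"
    have s: "of_real (1 - (norm z)\<^sup>2) = s" "s \<noteq> 0"
      using norm_disc[OF z] unfolding s_def
      by (simp_all add: complex_norm_square flip: complex_norm_square del: of_real_power of_real_diff)
        (auto simp flip: complex_norm_square)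
    define D' where "D' = (\<lambda>v. - 2 * cnj (z * f z / 8 * v)
      + (2 * z * cnj (z\<^sup>2 * f z / 8 * v) + 2 * v * cnj (C z)) + deriv (deriv h) z * v)"
    define E' where "E' = (\<lambda>v. (cnj (f z) * (2 * s * - (z * cnj v + v * cnj z))
      + cnj (deriv f z * v) * s\<^sup>2) / 8)"
    have D': "(D has_derivative D') (at z)"
      unfolding D_def D'_def using z
      by (auto intro!: derivative_eq_intros B[THEN has_field_derivative_imp_has_derivative]
          C[THEN has_field_derivative_imp_has_derivative]
          holomorphic_derivI[OF holomorphic_deriv[OF h], THEN has_field_derivative_imp_has_derivative])
    have E': "(E has_derivative E') (at z)"
      unfolding E_def E'_def s_def using z
      by (auto intro!: derivative_eq_intros holomorphic_derivI[OF f, THEN has_field_derivative_imp_has_derivative]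
          simp: fun_eq_iff field_simps)
    have "ddir (\<lambda>x. ddir \<eta> x e) z v = D' v * e + E' v * cnj e" for e v
    proof (rule ddir_eq, rule has_derivative_transform_within_open[where s = disc])
      show "((\<lambda>x. D x * e + E x * cnj e) has_derivative (\<lambda>v. D' v * e + E' v * cnj e)) (at z)"
        by (auto intro!: derivative_eq_intros D' E')
    qed (use z e1 in auto)
    \<comment> \<open>Both brackets are twice the mixed derivative of \<open>\<eta>\<close> in z and
      cnj z, and their sum is the Laplacian. Since \<open>f\<close> is holomorphic, differentiating
      \<open>E\<close> in z only meets the factor (1 - z cnj z)^2.\<close>
    then have "ddir (\<lambda>x. ddir \<eta> x 1) z 1 + ddir (\<lambda>x. ddir \<eta> x \<i>) z \<i>
        = (D' 1 + \<i> * D' \<i>) + (E' 1 - \<i> * E' \<i>)"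
      by (simp add: algebra_simps)
    also have "D' 1 + \<i> * D' \<i> = - (cnj z * cnj (f z) * s / 2)"
      by (simp add: D'_def s_def power2_eq_square field_simps)
    also have "E' 1 - \<i> * E' \<i> = - (cnj z * cnj (f z) * s / 2)"
      by (simp add: E'_def field_simps)
    finally have "ddir (\<lambda>x. ddir \<eta> x 1) z 1 + ddir (\<lambda>x. ddir \<eta> x \<i>) z \<i>
        = - (cnj z * cnj (f z) * s)" by simp
    moreover have "ddir \<eta> z 1 + \<i> * ddir \<eta> z \<i> = cnj (f z) * s\<^sup>2 / 4"
      by (simp add: e1[OF z] E_def s_def algebra_simps)
    ultimately show "ddir (\<lambda>x. ddir \<eta> x 1) z 1 + ddir (\<lambda>x. ddir \<eta> x \<i>) z \<i>
      + 4 * cnj z / of_real (1 - (norm z)\<^sup>2) * (ddir \<eta> z 1 + \<i> * ddir \<eta> z \<i>) = 0"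
      using s(2) by (simp only: s(1)) (simp add: power2_eq_square)
  qed
qed

section \<open>Killing fields as holomorphic infinitesimal isometries\<close>

lemma killing_vf_holomorphic_iff:
  assumes "X holomorphic_on disc"
  shows "killing_vf X \<longleftrightarrow>
    (\<forall>z\<in>disc. 2 * (z \<bullet> X z) + (1 - (norm z)\<^sup>2) * Re (deriv X z) = 0)"
proof -
  \<comment> \<open>Holomorphy removes the trace-free summand of \<open>lie_metric_eq\<close>, so
    being Killing is the vanishing of one scalar factor.\<close>
  have lie: "lie_metric X z v w = (4 * (z \<bullet> X z) / (1 - (norm z)\<^sup>2) + 2 * Re (deriv X z)) * hyp_metric z v w"
    if z: "z \<in> disc" for z v w
    using smooth_on_differentiable[OF smooth_on_holomorphic[OF open_ball assms] open_ball z]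
    by (simp add: lie_metric_eq[OF z] ddir_holomorphic[OF assms z])
  have "(\<forall>v w. lie_metric X z v w = 0) \<longleftrightarrow> 2 * (z \<bullet> X z) + (1 - (norm z)\<^sup>2) * Re (deriv X z) = 0"
    if z: "z \<in> disc" for z
  proof -
    have "hyp_metric z 1 1 \<noteq> 0"
      using conf_pos[OF z] by (simp add: hyp_metric_def)
    then have "(\<forall>v w. lie_metric X z v w = 0) \<longleftrightarrow>
        4 * (z \<bullet> X z) / (1 - (norm z)\<^sup>2) + 2 * Re (deriv X z) = 0"
      unfolding lie[OF z] by auto
    also have "\<dots> \<longleftrightarrow> 2 * (z \<bullet> X z) + (1 - (norm z)\<^sup>2) * Re (deriv X z) = 0"
      using norm_disc[OF z] by (auto simp: field_simps)
    finally show ?thesis .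
  qed
  then show ?thesis
    using smooth_on_holomorphic[OF open_ball assms] by (simp add: killing_vf_def)
qed

lemma killing_vf_imp_holomorphic:
  assumes "killing_vf X"
  shows "X holomorphic_on disc"
proof (rule holomorphic_on_disc_CR)
  have smooth: "smooth_on disc X" using assms by (simp add: killing_vf_def)
  fix z assume z: "z \<in> disc"
  show "(X has_derivative ddir X z) (at z)"
    by (rule smooth_on_disc_has_derivative[OF smooth z])
  define p where "p = ddir X z 1 + \<i> * ddir X z \<i>"
  define m where "m = 4 * (z \<bullet> X z) / (1 - (norm z)\<^sup>2) + Re (ddir X z 1) + Im (ddir X z \<i>)"
  have "Re (of_real (conf z) * cnj p * v * w) + m * hyp_metric z v w = 0" for v w
    using lie_metric_eq[OF z smooth_on_differentiable[OF smooth open_ball z]] assms z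
    by (simp add: killing_vf_def p_def m_def)
  \<comment> \<open>Three pairs of vectors separate \<open>m\<close>, Re p and Im p.\<close>
  from this[of 1 1] this[of \<i> \<i>] this[of 1 \<i>]
  have "conf z * (Re p + m) = 0" "conf z * (m - Re p) = 0" "conf z * Im p = 0"
    by (auto simp: hyp_metric_def inner_complex_def algebra_simps)
  then have "Re p + m = 0" "m - Re p = 0" "Im p = 0"
    using conf_pos[OF z] by simp_all
  then show "p = 0"
    by (simp add: complex_eq_iff)
qed

section \<open>Boundary values\<close>

lemma sets_circle_measure [measurable_cong]:
  "sets circle_measure = sets (restrict_space borel (sphere 0 1))"
  by (simp add: circle_measure_def)

lemma space_circle_measure [simp]: "space circle_measure = sphere 0 1"
  by (simp add: circle_measure_def space_restrict_space)

lemma measurable_cis_circle: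
  "cis \<in> measurable (restrict_space lborel {0..<2 * pi}) (restrict_space borel (sphere 0 1))"
  by (intro measurable_restrict_space2 measurable_restrict_space1)
    (auto intro!: borel_measurable_continuous_onI continuous_intros)

lemma emeasure_circle: "emeasure circle_measure (sphere 0 1) = ennreal (2 * pi)"
proof -
  have "emeasure circle_measure (sphere 0 1)
      = emeasure (restrict_space lborel {0..<2 * pi}) {0..<2 * pi}"
    unfolding circle_measure_def
    by (subst emeasure_distr[OF measurable_cis_circle])
      (auto simp: space_restrict_space sets_restrict_space_iff intro!: arg_cong2[where f = emeasure])
  also have "\<dots> = ennreal (2 * pi)"
    by (simp add: emeasure_restrict_space)
  finally show ?thesis .
qed

interpretation circle: finite_measure circle_measure
  by standard (simp add: emeasure_circle)

lemma measure_circle: "measure circle_measure (sphere 0 1) = 2 * pi"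
  by (simp add: measure_def emeasure_circle)

lemma circle_measurable_continuous:
  "continuous_on (sphere 0 1) g \<Longrightarrow> g \<in> borel_measurable circle_measure"
  using borel_measurable_continuous_on_restrict[of "sphere 0 1" g]
  by (simp add: measurable_cong_sets[OF sets_circle_measure refl])

lemma circle_integrable_continuous:
  fixes g :: "complex \<Rightarrow> 'b::{banach, second_countable_topology}"
  assumes "continuous_on (sphere 0 1) g"
  shows "integrable circle_measure g"
proof -
  have "bounded (g ` sphere 0 1)"
    using assms by (intro compact_imp_bounded compact_continuous_image) auto
  then obtain B where "\<And>z. z \<in> sphere 0 1 \<Longrightarrow> norm (g z) \<le> B"
    unfolding bounded_iff by blast
  then show ?thesis
    by (intro circle.integrable_const_bound[where B = B] circle_measurable_continuous assms AE_I2) simp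
qed

text \<open>Contour integrals along circles unfold to gauge integrals over a closed parameter
  interval. The half-open interval in \<open>circle_measure\<close> differs from it by the null set
  containing only 2 pi.\<close>

lemma circle_has_integral:
  assumes g: "continuous_on (sphere 0 1) (g :: complex \<Rightarrow> complex)"
  shows "((\<lambda>t. g (cis t)) has_integral (LINT z|circle_measure. g z)) {0..2 * pi}"
proof -
  have "integrable (restrict_space lborel {0..<2 * pi}) (\<lambda>t. g (cis t))"
    using circle_integrable_continuous[OF g] unfolding circle_measure_def
    by (rule integrable_distr[OF measurable_cis_circle])
  then have int: "set_integrable lborel {0..<2 * pi} (\<lambda>t. g (cis t))"
    by (simp add: integrable_restrict_space set_integrable_def)
  have "(LINT z|circle_measure. g z) = (LINT t|restrict_space lborel {0..<2 * pi}. g (cis t))"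
    unfolding circle_measure_def
    by (intro integral_distr measurable_cis_circle borel_measurable_continuous_on_restrict g)
  also have "\<dots> = (LINT t:{0..<2 * pi}|lborel. g (cis t))"
    by (simp add: integral_restrict_space set_lebesgue_integral_def)
  finally have "((\<lambda>t. g (cis t)) has_integral (LINT z|circle_measure. g z)) {0..<2 * pi}"
    using set_borel_integral_eq_integral[OF int] by (simp add: has_integral_iff)
  moreover have "negligible {x \<in> {0..<2 * pi} - {0..2 * pi}. g (cis x) \<noteq> 0}"
    by (rule negligible_subset[OF negligible_empty]) auto
  moreover have "negligible {x \<in> {0..2 * pi} - {0..<2 * pi}. g (cis x) \<noteq> 0}"
    by (rule negligible_subset[of "{2 * pi}"]) auto
  ultimately show ?thesis
    using has_integral_spike_set_eq[of "{0..<2 * pi}" "{0..2 * pi}" "\<lambda>t. g (cis t)"] by blast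
qed

text \<open>Substituting u = r z with du = r i z dt carries a contour integral over the circle of
  radius \<open>r\<close> to the unit circle. The factor \<open>c\<close> collects the powers of
  \<open>r\<close> and the i that are left over.\<close>

lemma circle_integral_contour:
  assumes F: "(F has_contour_integral I) (circlepath 0 r)"
    and g: "continuous_on (sphere 0 1) g"
    and eq: "\<And>z. z \<in> sphere 0 1 \<Longrightarrow> F (of_real r * z) * of_real r * \<i> * z = c * g z"
  shows "c * (LINT z|circle_measure. g z) = I"
proof -
  have "((\<lambda>t. F (0 + of_real r * cis t) * of_real r * \<i> * cis t) has_integral I) {0..2 * pi}"
    using F unfolding circlepath_def by (subst (asm) has_contour_integral_part_circlepath_iff) auto
  then have "((\<lambda>t. c * g (cis t)) has_integral I) {0..2 * pi}"
    using eq by simp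
  moreover have "((\<lambda>t. c * g (cis t)) has_integral (c * (LINT z|circle_measure. g z))) {0..2 * pi}"
    by (rule has_integral_mult_right[OF circle_has_integral[OF g]])
  ultimately show ?thesis
    by (rule has_integral_unique[symmetric])
qed

lemma continuous_on_circle_dilate:
  assumes "continuous_on disc X" "0 \<le> r" "r < 1"
  shows "continuous_on (sphere 0 1) (\<lambda>z. X (of_real r * z))"
  by (rule continuous_on_compose2[OF assms(1)])
    (use assms(2,3) in \<open>auto simp: norm_mult intro!: continuous_intros\<close>)

section \<open>Fourier coefficients of holomorphic functions on concentric circles\<close>

lemma circle_Fourier_nonneg:
  fixes X :: "complex \<Rightarrow> complex"
  assumes X: "X holomorphic_on disc" and r: "0 < r" "r < 1"
  shows "(LINT z|circle_measure. X (of_real r * z) * cnj z ^ n)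
    = 2 * pi * ((deriv ^^ n) X 0 / fact n) * of_real r ^ n"
proof -
  have "cball (0::complex) r \<subseteq> disc" using r by auto
  then have "((\<lambda>u. X u / (u - 0) ^ Suc n) has_contour_integral
      (2 * pi * \<i> / fact n * (deriv ^^ n) X 0)) (circlepath 0 r)"
    using X r by (intro Cauchy_has_contour_integral_higher_derivative_circlepath)
      (auto intro: holomorphic_on_imp_continuous_on holomorphic_on_subset)
  \<comment> \<open>On the unit circle \<open>cnj z\<close> inverts \<open>z\<close>, so the kernel
    of Cauchy's formula for the n-th derivative becomes the weight \<open>cnj z ^ n\<close>.\<close>
  moreover have "X (of_real r * z) / (of_real r * z - 0) ^ Suc n * of_real r * \<i> * z
      = \<i> / of_real r ^ n * (X (of_real r * z) * cnj z ^ n)" if "z \<in> sphere 0 1" for z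
  proof -
    have z: "z * cnj z = 1" "z \<noteq> 0"
      using that complex_norm_square[of z] by auto
    have "X (of_real r * z) / (of_real r * z - 0) ^ Suc n * of_real r * \<i> * z
        = X (of_real r * z) * \<i> / (of_real r ^ n * z ^ n) * (z * cnj z) ^ n"
      using r z by (simp add: power_mult_distrib)
    also have "\<dots> = \<i> / of_real r ^ n * (X (of_real r * z) * cnj z ^ n)"
      unfolding power_mult_distrib using r z(2) by simp
    finally show ?thesis .
  qed
  ultimately have "\<i> / of_real r ^ n * (LINT z|circle_measure. X (of_real r * z) * cnj z ^ n)
      = 2 * pi * \<i> / fact n * (deriv ^^ n) X 0"
    using X r by (intro circle_integral_contour continuous_intros continuous_on_circle_dilate
        holomorphic_on_imp_continuous_on) auto
  then show ?thesis using r by (simp add: field_simps)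
qed

text \<open>Cauchy's formula, with derivative order 0, for the function X u * u ^ n, which vanishes
  at the origin because n is positive.\<close>

lemma circle_Fourier_neg:
  fixes X :: "complex \<Rightarrow> complex"
  assumes X: "X holomorphic_on disc" and r: "0 < r" "r < 1" and n: "0 < n"
  shows "(LINT z|circle_measure. X (of_real r * z) * z ^ n) = 0"
proof -
  have "cball (0::complex) r \<subseteq> disc" using r by auto
  then have "X holomorphic_on cball 0 r" by (rule holomorphic_on_subset[OF X])
  then have F: "((\<lambda>u. (X u * u ^ n) / (u - 0) ^ Suc 0) has_contour_integral
      (2 * pi * \<i> / fact 0 * (deriv ^^ 0) (\<lambda>u. X u * u ^ n) 0)) (circlepath 0 r)"
    using r by (intro Cauchy_has_contour_integral_higher_derivative_circlepath)
      (auto intro!: holomorphic_on_imp_continuous_on continuous_intros holomorphic_intros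
        intro: holomorphic_on_subset)
  have eq: "(X (of_real r * z) * (of_real r * z) ^ n) / (of_real r * z - 0) ^ Suc 0 * of_real r * \<i> * z
      = \<i> * of_real r ^ n * (X (of_real r * z) * z ^ n)" if "z \<in> sphere 0 1" for z
  proof -
    have "z \<noteq> 0" using that by auto
    then show ?thesis using r by (simp add: power_mult_distrib)
  qed
  have "\<i> * of_real r ^ n * (LINT z|circle_measure. X (of_real r * z) * z ^ n)
      = 2 * pi * \<i> / fact 0 * (deriv ^^ 0) (\<lambda>u. X u * u ^ n) 0"
    using X r by (intro circle_integral_contour[OF F _ eq] continuous_intros continuous_on_circle_dilate
        holomorphic_on_imp_continuous_on) auto
  then show ?thesis using r n by (simp add: power_0_left)
qed

section \<open>Square-integrable functions on the circle\<close>

lemma square_integrable_imp_integrable: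
  fixes g :: "complex \<Rightarrow> complex"
  assumes "g \<in> borel_measurable circle_measure" "integrable circle_measure (\<lambda>z. (norm (g z))\<^sup>2)"
  shows "integrable circle_measure g"
proof (rule Bochner_Integration.integrable_bound)
  show "integrable circle_measure (\<lambda>z. 1 + (norm (g z))\<^sup>2)"
    using assms by simp
  have "norm w \<le> norm (1 + (norm w)\<^sup>2)" for w :: complex
    using sum_squares_bound[of 1 "norm w"] norm_ge_zero[of w] unfolding real_norm_def mult_1_right power_one by linarith
  then show "AE z in circle_measure. norm (g z) \<le> norm (1 + (norm (g z))\<^sup>2)" by simp
qed (use assms in simp)

lemma circle_L1_le_L2:
  fixes g :: "complex \<Rightarrow> complex"
  assumes g: "g \<in> borel_measurable circle_measure" "integrable circle_measure (\<lambda>z. (norm (g z))\<^sup>2)"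
  shows "(LINT z|circle_measure. norm (g z))
    \<le> sqrt (2 * pi * (LINT z|circle_measure. (norm (g z))\<^sup>2))"
proof (rule real_le_rsqrt)
  define I where "I = (LINT z|circle_measure. norm (g z))"
  \<comment> \<open>The mean of |g|; nonnegativity of the variance is the Cauchy-Schwarz inequality
    against the constant 1.\<close>
  define c where "c = I / (2 * pi)"
  have int: "integrable circle_measure (\<lambda>z. norm (g z))"
    using square_integrable_imp_integrable[OF g] by simp
  have "0 \<le> (LINT z|circle_measure. (norm (g z) - c)\<^sup>2)"
    by simp
  also have "\<dots> = (LINT z|circle_measure. (norm (g z))\<^sup>2 - (2 * c) * norm (g z) + c\<^sup>2)"
    by (simp add: power2_diff algebra_simps)
  also have "\<dots> = (LINT z|circle_measure. (norm (g z))\<^sup>2) - 2 * c * I + 2 * pi * c\<^sup>2"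
    using int g by (simp add: I_def measure_circle)
  finally show "I\<^sup>2 \<le> 2 * pi * (LINT z|circle_measure. (norm (g z))\<^sup>2)"
    by (simp add: c_def power2_eq_square field_simps)
qed

text \<open>The bound |a + b|^2 \<le> 2 |a|^2 + 2 |b|^2 stands in for the triangle inequality in L2;
  the factor 2 is harmless for quantities tending to 0.\<close>

lemma square_integrable_add:
  fixes g h :: "complex \<Rightarrow> complex"
  assumes "g \<in> borel_measurable circle_measure" "integrable circle_measure (\<lambda>z. (norm (g z))\<^sup>2)"
    and "h \<in> borel_measurable circle_measure" "integrable circle_measure (\<lambda>z. (norm (h z))\<^sup>2)"
  shows "integrable circle_measure (\<lambda>z. (norm (g z + h z))\<^sup>2)"
    and "(LINT z|circle_measure. (norm (g z + h z))\<^sup>2)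
      \<le> 2 * (LINT z|circle_measure. (norm (g z))\<^sup>2) + 2 * (LINT z|circle_measure. (norm (h z))\<^sup>2)"
proof -
  have le: "(norm (a + b))\<^sup>2 \<le> 2 * (norm a)\<^sup>2 + 2 * (norm b)\<^sup>2" for a b :: complex
  proof -
    have "(norm (a + b))\<^sup>2 \<le> (norm a + norm b)\<^sup>2"
      by (intro power_mono norm_triangle_ineq) simp
    also have "\<dots> \<le> 2 * (norm a)\<^sup>2 + 2 * (norm b)\<^sup>2"
      using sum_squares_bound[of "norm a" "norm b"] by (simp add: power2_sum)
    finally show ?thesis .
  qed
  have int: "integrable circle_measure (\<lambda>z. 2 * (norm (g z))\<^sup>2 + 2 * (norm (h z))\<^sup>2)"
    using assms by simp
  then show "integrable circle_measure (\<lambda>z. (norm (g z + h z))\<^sup>2)"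
    by (rule Bochner_Integration.integrable_bound) (use assms le in \<open>auto simp: abs_of_nonneg\<close>)
  then have "(LINT z|circle_measure. (norm (g z + h z))\<^sup>2)
      \<le> (LINT z|circle_measure. 2 * (norm (g z))\<^sup>2 + 2 * (norm (h z))\<^sup>2)"
    using int le by (intro integral_mono) auto
  then show "(LINT z|circle_measure. (norm (g z + h z))\<^sup>2)
      \<le> 2 * (LINT z|circle_measure. (norm (g z))\<^sup>2) + 2 * (LINT z|circle_measure. (norm (h z))\<^sup>2)"
    using assms by simp
qed

section \<open>Vector fields with square-integrable boundary values\<close>

lemma has_L2_boundary_value_square_integrable:
  assumes XY: "has_L2_boundary_value X Y" and \<epsilon>: "0 < \<epsilon>" "\<epsilon> \<le> 1"
  shows "(\<lambda>z. X (of_real (1 - \<epsilon>) * z) - Y z) \<in> borel_measurable circle_measure"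
    and "integrable circle_measure (\<lambda>z. (norm (X (of_real (1 - \<epsilon>) * z) - Y z))\<^sup>2)"
proof -
  have c: "continuous_on (sphere 0 1) (\<lambda>z. X (of_real (1 - \<epsilon>) * z))"
    using XY \<epsilon> by (intro continuous_on_circle_dilate) (auto simp: has_L2_boundary_value_def)
  have Y: "(\<lambda>z. - Y z) \<in> borel_measurable circle_measure"
    "integrable circle_measure (\<lambda>z. (norm (- Y z))\<^sup>2)"
    using XY by (simp_all add: has_L2_boundary_value_def)
  have X: "(\<lambda>z. X (of_real (1 - \<epsilon>) * z)) \<in> borel_measurable circle_measure"
    by (rule circle_measurable_continuous[OF c])
  show "(\<lambda>z. X (of_real (1 - \<epsilon>) * z) - Y z) \<in> borel_measurable circle_measure"
    using borel_measurable_add[OF X Y(1)] by simp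
  have "integrable circle_measure (\<lambda>z. (norm (X (of_real (1 - \<epsilon>) * z)))\<^sup>2)"
    by (intro circle_integrable_continuous continuous_intros c)
  from square_integrable_add(1)[OF X this Y]
  show "integrable circle_measure (\<lambda>z. (norm (X (of_real (1 - \<epsilon>) * z) - Y z))\<^sup>2)"
    by simp
qed

lemma eventually_at_right_0_1: "\<forall>\<^sub>F \<epsilon> in at_right (0::real). 0 < \<epsilon> \<and> \<epsilon> < 1"
  unfolding eventually_at_right[OF zero_less_one] by (intro exI[of _ 1]) auto

lemma has_L2_boundary_value_add_scaled:
  fixes c :: real
  assumes "has_L2_boundary_value X Y" "has_L2_boundary_value X' Y'"
  shows "has_L2_boundary_value (\<lambda>z. X z + c *\<^sub>R X' z) (\<lambda>z. Y z + c *\<^sub>R Y' z)"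
proof -
  define d where "d = (\<lambda>\<epsilon> z. X (of_real (1 - \<epsilon>) * z) - Y z)"
  define d' where "d' = (\<lambda>\<epsilon> z. X' (of_real (1 - \<epsilon>) * z) - Y' z)"
  have cY': "(\<lambda>z. c *\<^sub>R Y' z) \<in> borel_measurable circle_measure"
    "integrable circle_measure (\<lambda>z. (norm (c *\<^sub>R Y' z))\<^sup>2)"
    using assms(2) by (auto simp: has_L2_boundary_value_def power_mult_distrib)
  have lim: "((\<lambda>\<epsilon>. 2 * (LINT z|circle_measure. (norm (d \<epsilon> z))\<^sup>2)
      + 2 * (c\<^sup>2 * (LINT z|circle_measure. (norm (d' \<epsilon> z))\<^sup>2))) \<longlongrightarrow> 2 * 0 + 2 * (c\<^sup>2 * 0)) (at_right 0)"
    using assms unfolding has_L2_boundary_value_def d_def d'_def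
    by (intro tendsto_intros) auto
  have "(LINT z|circle_measure. (norm (d \<epsilon> z + c *\<^sub>R d' \<epsilon> z))\<^sup>2)
      \<le> 2 * (LINT z|circle_measure. (norm (d \<epsilon> z))\<^sup>2)
      + 2 * (c\<^sup>2 * (LINT z|circle_measure. (norm (d' \<epsilon> z))\<^sup>2))" if "0 < \<epsilon> \<and> \<epsilon> < 1" for \<epsilon>
  proof -
    have 1: "d \<epsilon> \<in> borel_measurable circle_measure" "integrable circle_measure (\<lambda>z. (norm (d \<epsilon> z))\<^sup>2)"
      "d' \<epsilon> \<in> borel_measurable circle_measure" "integrable circle_measure (\<lambda>z. (norm (d' \<epsilon> z))\<^sup>2)"
      using has_L2_boundary_value_square_integrable[OF assms(1), of \<epsilon>]
        has_L2_boundary_value_square_integrable[OF assms(2), of \<epsilon>] that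
      by (simp_all add: d_def[abs_def] d'_def[abs_def])
    have "(\<lambda>z. c *\<^sub>R d' \<epsilon> z) \<in> borel_measurable circle_measure"
      "integrable circle_measure (\<lambda>z. (norm (c *\<^sub>R d' \<epsilon> z))\<^sup>2)"
      using 1 by (auto simp: power_mult_distrib)
    from square_integrable_add(2)[OF 1(1,2) this] show ?thesis
      by (simp add: power_mult_distrib)
  qed
  then have "((\<lambda>\<epsilon>. LINT z|circle_measure. (norm (d \<epsilon> z + c *\<^sub>R d' \<epsilon> z))\<^sup>2) \<longlongrightarrow> 0) (at_right 0)"
    by (intro tendsto_sandwich[OF _ _ tendsto_const[of 0] lim[simplified]])
      (auto intro: eventually_mono[OF eventually_at_right_0_1])
  moreover have "d \<epsilon> z + c *\<^sub>R d' \<epsilon> z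
      = X (of_real (1 - \<epsilon>) * z) + c *\<^sub>R X' (of_real (1 - \<epsilon>) * z) - (Y z + c *\<^sub>R Y' z)" for \<epsilon> z
    by (simp add: d_def d'_def algebra_simps)
  ultimately show ?thesis
    using assms square_integrable_add(1)[OF _ _ cY', of Y] cY'(1)
    unfolding has_L2_boundary_value_def
    by (auto intro!: continuous_intros)
qed

text \<open>The scalar is real because tangential fields form a real vector space. The cases c = 1
  and c = - 1 give sums and differences.\<close>

lemma extends_tangentially_add_scaled:
  fixes c :: real
  assumes "extends_tangentially X" "extends_tangentially X'"
  shows "extends_tangentially (\<lambda>z. X z + c *\<^sub>R X' z)"
proof -
  obtain Y Y' g g' where *: "has_L2_boundary_value X Y" "has_L2_boundary_value X' Y'"
    and g: "AE z in circle_measure. Y z = of_real (g z) * (\<i> * z)"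
      "AE z in circle_measure. Y' z = of_real (g' z) * (\<i> * z)"
    using assms unfolding extends_tangentially_def tangential_def by metis
  have "AE z in circle_measure. Y z + c *\<^sub>R Y' z = of_real (g z + c * g' z) * (\<i> * z)"
    using g by eventually_elim (simp add: scaleR_conv_of_real algebra_simps)
  then have "tangential (\<lambda>z. Y z + c *\<^sub>R Y' z)"
    unfolding tangential_def by (rule exI[of _ "\<lambda>z. g z + c * g' z"])
  then show ?thesis
    using has_L2_boundary_value_add_scaled[OF *] unfolding extends_tangentially_def by blast
qed

text \<open>Uniform radial convergence on a circle of finite length gives L2 convergence: the
  squared error is at most K^2 \<epsilon>. Measurability of \<open>Y\<close> comes for free, as a
  pointwise limit of continuous functions.\<close>

lemma has_L2_boundary_valueI:
  assumes X: "continuous_on disc X"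
    and K: "\<And>z \<epsilon>. z \<in> sphere 0 1 \<Longrightarrow> 0 < \<epsilon> \<Longrightarrow> \<epsilon> < 1 \<Longrightarrow>
      norm (X (of_real (1 - \<epsilon>) * z) - Y z) \<le> K * sqrt \<epsilon>"
  shows "has_L2_boundary_value X Y"
proof -
  \<comment> \<open>The shift by two keeps \<epsilon> = 1 / (n + 2) strictly below 1, where
    \<open>K\<close> applies. The radius r 0 = 1/2 also serves to bound \<open>Y\<close>.\<close>
  define r where "r n = 1 - 1 / real (Suc (Suc n))" for n
  have "continuous_on (sphere 0 1) (\<lambda>z. X (of_real (r n) * z))" for n
    by (rule continuous_on_circle_dilate[OF X]) (auto simp: r_def)
  then have meas: "(\<lambda>z. X (of_real (r n) * z)) \<in> borel_measurable circle_measure" for n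
    by (rule circle_measurable_continuous)
  have sqrt0: "(\<lambda>n. K * sqrt (1 / real (Suc (Suc n)))) \<longlonglongrightarrow> 0"
  proof -
    have "(\<lambda>n. K * sqrt (1 / real (Suc (Suc n)))) \<longlonglongrightarrow> K * sqrt 0"
      by (intro tendsto_intros LIMSEQ_Suc lim_1_over_n)
    then show ?thesis by simp
  qed
  have Y: "Y \<in> borel_measurable circle_measure"
  proof (rule borel_measurable_LIMSEQ_metric[OF meas])
    fix z assume z: "z \<in> space circle_measure"
    have "(\<lambda>n. X (of_real (r n) * z) - Y z) \<longlonglongrightarrow> 0"
      by (rule Lim_null_comparison[OF _ sqrt0], rule always_eventually)
        (use K[of z "1 / real (Suc (Suc _))"] z in \<open>auto simp: r_def\<close>)
    then show "(\<lambda>n. X (of_real (r n) * z)) \<longlonglongrightarrow> Y z" by (simp add: LIM_zero_iff)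
  qed
  have bX: "bounded ((\<lambda>z. X (of_real (r 0) * z)) ` sphere 0 1)"
    by (intro compact_imp_bounded compact_continuous_image continuous_on_circle_dilate[OF X])
      (auto simp: r_def)
  then obtain B where B: "\<And>z. z \<in> sphere 0 1 \<Longrightarrow> norm (X (of_real (r 0) * z)) \<le> B"
    unfolding bounded_iff by blast
  have "norm (Y z) \<le> B + K * sqrt (1 / 2)" if "z \<in> sphere 0 1" for z
  proof -
    have "norm (Y z) \<le> norm (X (of_real (r 0) * z)) + norm (X (of_real (r 0) * z) - Y z)"
      using norm_triangle_ineq4[of "X (of_real (r 0) * z)" "X (of_real (r 0) * z) - Y z"] by simp
    moreover have "norm (X (of_real (r 0) * z) - Y z) \<le> K * sqrt (1 / 2)"
      using K[of z "1 / 2"] that by (simp add: r_def)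
    ultimately show ?thesis using B[OF that] by linarith
  qed
  then have "integrable circle_measure (\<lambda>z. (norm (Y z))\<^sup>2)"
    using Y by (intro circle.integrable_const_bound[where B = "(B + K * sqrt (1 / 2))\<^sup>2"] AE_I2)
      (auto intro!: power_mono)
  moreover have "((\<lambda>\<epsilon>. LINT z|circle_measure. (norm (X (of_real (1 - \<epsilon>) * z) - Y z))\<^sup>2) \<longlongrightarrow> 0) (at_right 0)"
  proof (rule Lim_null_comparison)
    show "((\<lambda>\<epsilon>. 2 * pi * (K\<^sup>2 * \<epsilon>)) \<longlongrightarrow> 0) (at_right 0)"
      by (auto intro!: tendsto_eq_intros)
    show "\<forall>\<^sub>F \<epsilon> in at_right 0. norm (LINT z|circle_measure. (norm (X (of_real (1 - \<epsilon>) * z) - Y z))\<^sup>2)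
        \<le> 2 * pi * (K\<^sup>2 * \<epsilon>)"
      using eventually_at_right_0_1
    proof eventually_elim
      case (elim \<epsilon>)
      have "(norm (X (of_real (1 - \<epsilon>) * z) - Y z))\<^sup>2 \<le> K\<^sup>2 * \<epsilon>" if "z \<in> sphere 0 1" for z
      proof -
        have "(norm (X (of_real (1 - \<epsilon>) * z) - Y z))\<^sup>2 \<le> (K * sqrt \<epsilon>)\<^sup>2"
          using K[OF that] elim by (intro power_mono) auto
        then show ?thesis using elim by (simp add: power_mult_distrib)
      qed
      then have "(LINT z|circle_measure. (norm (X (of_real (1 - \<epsilon>) * z) - Y z))\<^sup>2)
          \<le> (LINT z|circle_measure. K\<^sup>2 * \<epsilon>)"
        using elim by (intro integral_mono_AE' AE_I2) auto
      then show ?case by (simp add: measure_circle)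
    qed
  qed
  ultimately show ?thesis
    unfolding has_L2_boundary_value_def using X Y by simp
qed

text \<open>Fourier coefficients pass to the boundary: with |w| \<le> 1 their error is at most the
  L1 norm of the difference, hence controlled by its L2 norm. The weights in use are powers of z and
  cnj z.\<close>

lemma has_L2_boundary_value_tendsto:
  assumes XY: "has_L2_boundary_value X Y" and w: "continuous_on (sphere 0 1) w"
    and w1: "\<And>z. z \<in> sphere 0 1 \<Longrightarrow> norm (w z) \<le> 1"
  shows "((\<lambda>\<epsilon>. LINT z|circle_measure. X (of_real (1 - \<epsilon>) * z) * w z)
    \<longlongrightarrow> (LINT z|circle_measure. Y z * w z)) (at_right 0)"
proof -
  define d where "d = (\<lambda>\<epsilon> z. X (of_real (1 - \<epsilon>) * z) - Y z)"
  have X: "continuous_on disc X"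
    using XY unfolding has_L2_boundary_value_def by blast
  have Y: "integrable circle_measure Y"
    using XY unfolding has_L2_boundary_value_def by (blast intro: square_integrable_imp_integrable)
  have wm: "w \<in> borel_measurable circle_measure" by (rule circle_measurable_continuous[OF w])
  have mult: "integrable circle_measure (\<lambda>z. g z * w z)" "norm (LINT z|circle_measure. g z * w z)
      \<le> (LINT z|circle_measure. norm (g z))" if "integrable circle_measure g" for g
  proof -
    have le: "norm (g z * w z) \<le> norm (g z)" if "z \<in> sphere 0 1" for z
      using mult_left_mono[OF w1[OF that] norm_ge_zero[of "g z"]] by (simp add: norm_mult)
    show int: "integrable circle_measure (\<lambda>z. g z * w z)"
      using that wm le by (intro Bochner_Integration.integrable_bound[OF that] AE_I2) auto
    have "norm (LINT z|circle_measure. g z * w z) \<le> (LINT z|circle_measure. norm (g z * w z))"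
      by (rule integral_norm_bound)
    also have "\<dots> \<le> (LINT z|circle_measure. norm (g z))"
      using int that le by (intro integral_mono) auto
    finally show "norm (LINT z|circle_measure. g z * w z) \<le> (LINT z|circle_measure. norm (g z))" .
  qed
  have "((\<lambda>\<epsilon>. (LINT z|circle_measure. X (of_real (1 - \<epsilon>) * z) * w z)
      - (LINT z|circle_measure. Y z * w z)) \<longlongrightarrow> 0) (at_right 0)"
  proof (rule Lim_null_comparison)
    have "((\<lambda>\<epsilon>. sqrt (2 * pi * (LINT z|circle_measure. (norm (d \<epsilon> z))\<^sup>2))) \<longlongrightarrow> sqrt (2 * pi * 0)) (at_right 0)"
      using XY unfolding has_L2_boundary_value_def d_def by (intro tendsto_intros) auto
    then show "((\<lambda>\<epsilon>. sqrt (2 * pi * (LINT z|circle_measure. (norm (d \<epsilon> z))\<^sup>2))) \<longlongrightarrow> 0) (at_right 0)"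
      by simp
    show "\<forall>\<^sub>F \<epsilon> in at_right 0. norm ((LINT z|circle_measure. X (of_real (1 - \<epsilon>) * z) * w z)
      - (LINT z|circle_measure. Y z * w z)) \<le> sqrt (2 * pi * (LINT z|circle_measure. (norm (d \<epsilon> z))\<^sup>2))"
      using eventually_at_right_0_1
    proof eventually_elim
      case (elim \<epsilon>)
      have Xi: "integrable circle_measure (\<lambda>z. X (of_real (1 - \<epsilon>) * z))"
        using elim by (intro circle_integrable_continuous continuous_on_circle_dilate X) auto
      have "d \<epsilon> \<in> borel_measurable circle_measure" "integrable circle_measure (\<lambda>z. (norm (d \<epsilon> z))\<^sup>2)"
        using has_L2_boundary_value_square_integrable[OF XY, of \<epsilon>] elim
        by (simp_all add: d_def[abs_def])
      note d = this circle_L1_le_L2[OF this] square_integrable_imp_integrable[OF this]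
      have "(LINT z|circle_measure. X (of_real (1 - \<epsilon>) * z) * w z) - (LINT z|circle_measure. Y z * w z)
          = (LINT z|circle_measure. d \<epsilon> z * w z)"
        using mult(1)[OF Xi] mult(1)[OF Y] by (simp add: d_def left_diff_distrib)
      then show ?case
        using mult(2)[OF d(4)] d(3) by simp
    qed
  qed
  then show ?thesis by (simp add: LIM_zero_iff)
qed

section \<open>Holomorphic vector fields with tangential boundary values\<close>

text \<open>Y cnj z is i times a real function, whose Fourier coefficients at opposite indices are
  conjugate; multiplying by z shifts indices by one. The second relation is the index that this
  reflection fixes. The real factor carries no measurability, so all integrands are built from
  \<open>Y\<close>.\<close>

lemma tangential_moments:
  assumes Y: "Y \<in> borel_measurable circle_measure" and t: "tangential Y"
  shows "(LINT z|circle_measure. Y z * cnj z ^ Suc (Suc k)) = - cnj (LINT z|circle_measure. Y z * z ^ k)"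
    and "(LINT z|circle_measure. Y z * cnj z ^ 1) = - cnj (LINT z|circle_measure. Y z * cnj z ^ 1)"
proof -
  obtain g where g: "AE z in circle_measure. Y z = of_real (g z) * (\<i> * z)"
    using t unfolding tangential_def by blast
  have m: "(\<lambda>z. z ^ n) \<in> borel_measurable circle_measure"
    "(\<lambda>z. cnj z ^ n) \<in> borel_measurable circle_measure" for n
    by (intro circle_measurable_continuous continuous_intros)+
  have cnj: "(\<lambda>z. - cnj (h z)) \<in> borel_measurable circle_measure"
    if "h \<in> borel_measurable circle_measure" for h
    using measurable_compose[OF that borel_measurable_continuous_onI[of cnj]]
    by (intro borel_measurable_uminus) (auto intro!: continuous_intros)
  have unit: "AE z in circle_measure. z * cnj z = 1"
  proof (rule AE_I2)
    show "z * cnj z = 1" if "z \<in> space circle_measure" for z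
      using that complex_norm_square[of z] by simp
  qed
  have "AE z in circle_measure. Y z * cnj z ^ Suc (Suc k) = - cnj (Y z * z ^ k)"
    using g unit
  proof eventually_elim
    case (elim z)
    have "Y z * cnj z ^ Suc (Suc k) = of_real (g z) * \<i> * (z * cnj z) * (cnj z * cnj z ^ k)"
      by (simp add: elim(1) mult_ac)
    then show ?case by (simp add: elim)
  qed
  then have "(LINT z|circle_measure. Y z * cnj z ^ Suc (Suc k)) = (LINT z|circle_measure. - cnj (Y z * z ^ k))"
    by (intro integral_cong_AE cnj borel_measurable_times Y m)
  then show "(LINT z|circle_measure. Y z * cnj z ^ Suc (Suc k)) = - cnj (LINT z|circle_measure. Y z * z ^ k)"
    by (simp only: Bochner_Integration.integral_minus Bochner_Integration.integral_cnj)
  have "AE z in circle_measure. Y z * cnj z ^ 1 = - cnj (Y z * cnj z ^ 1)"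
    using g unit
  proof eventually_elim
    case (elim z)
    have "Y z * cnj z ^ 1 = of_real (g z) * \<i> * (z * cnj z)"
      by (simp add: elim(1) mult_ac)
    then show ?case by (simp add: elim(2))
  qed
  then have "(LINT z|circle_measure. Y z * cnj z ^ 1) = (LINT z|circle_measure. - cnj (Y z * cnj z ^ 1))"
    by (intro integral_cong_AE cnj borel_measurable_times Y m)
  then show "(LINT z|circle_measure. Y z * cnj z ^ 1) = - cnj (LINT z|circle_measure. Y z * cnj z ^ 1)"
    by (simp only: Bochner_Integration.integral_minus Bochner_Integration.integral_cnj)
qed

text \<open>The Taylor series stops after degree two. The witnesses are c = a 0 and b = Im (a 1), as
  \<open>a 1\<close> is purely imaginary. It is applied to moments on the boundary and to moments on
  an interior circle.\<close>

lemma holomorphic_quadratic: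
  assumes X: "X holomorphic_on disc"
    and a: "\<And>n. a n = (deriv ^^ n) X 0 / fact n"
    and a3: "\<And>k. a (Suc (Suc (Suc k))) = 0" and a2: "a (Suc (Suc 0)) = - cnj (a 0)"
    and a1: "a 1 = - cnj (a 1)"
  shows "\<exists>c b. \<forall>z\<in>disc. X z = c + \<i> * of_real b * z - cnj c * z\<^sup>2"
proof (intro exI ballI)
  fix z assume z: "z \<in> disc"
  have "(\<lambda>n. a n * z ^ n) sums X z"
    using holomorphic_power_series[OF X z] by (simp add: a)
  moreover have "(\<lambda>n. a n * z ^ n) sums (\<Sum>n\<in>{0, 1, 2}. a n * z ^ n)"
  proof (rule sums_finite)
    fix n :: nat assume "n \<notin> {0, 1, 2}"
    then obtain k where "n = Suc (Suc (Suc k))"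
      by (metis One_nat_def Suc_1 insertCI not0_implies_Suc)
    then show "a n * z ^ n = 0" by (simp only: a3) simp
  qed simp
  ultimately have "X z = (\<Sum>n\<in>{0, 1, 2}. a n * z ^ n)"
    by (rule sums_unique2)
  also have "\<dots> = a 0 + a 1 * z + a (Suc (Suc 0)) * z\<^sup>2"
    by (simp add: numeral_2_eq_2)
  also have "\<dots> = a 0 + a 1 * z - cnj (a 0) * z\<^sup>2"
    by (simp add: a2)
  also have "a 1 = \<i> * of_real (Im (a 1))"
    using a1 by (simp add: complex_eq_iff)
  finally show "X z = a 0 + \<i> * of_real (Im (a 1)) * z - cnj (a 0) * z\<^sup>2" .
qed

lemma mult_eq_minus_mult_iff:
  fixes c x y :: "'a::idom"
  shows "c * x = - (c * y) \<longleftrightarrow> c = 0 \<or> x = - y"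
  using mult_cancel_left[of c x "- y"] by simp

lemma extends_tangentially_quadratic:
  assumes "X holomorphic_on disc" "extends_tangentially X"
  shows "\<exists>c b. \<forall>z\<in>disc. X z = c + \<i> * of_real b * z - cnj c * z\<^sup>2"
proof -
  obtain Y where Y: "has_L2_boundary_value X Y" "tangential Y"
    using assms(2) unfolding extends_tangentially_def by blast
  define a where "a n = (deriv ^^ n) X 0 / fact n" for n
  \<comment> \<open>Cauchy's formula gives the dilates the coefficients (1 - \<epsilon>)^n a n, up
    to 2 pi, and L2 convergence carries them to \<open>Y\<close>.\<close>
  have pos: "(LINT z|circle_measure. Y z * cnj z ^ n) = 2 * pi * a n" for n
  proof -
    have "((\<lambda>\<epsilon>. 2 * pi * a n * of_real (1 - \<epsilon>) ^ n) \<longlongrightarrow> 2 * pi * a n * of_real (1 - 0) ^ n) (at_right 0)"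
      by (intro tendsto_intros)
    moreover have "\<forall>\<^sub>F \<epsilon> in at_right 0. 2 * pi * a n * of_real (1 - \<epsilon>) ^ n
        = (LINT z|circle_measure. X (of_real (1 - \<epsilon>) * z) * cnj z ^ n)"
      using eventually_at_right_0_1
      by eventually_elim (subst circle_Fourier_nonneg[OF assms(1)], auto simp: a_def)
    ultimately have "((\<lambda>\<epsilon>. LINT z|circle_measure. X (of_real (1 - \<epsilon>) * z) * cnj z ^ n)
        \<longlongrightarrow> 2 * pi * a n * of_real (1 - 0) ^ n) (at_right 0)"
      by (rule Lim_transform_eventually)
    moreover have "((\<lambda>\<epsilon>. LINT z|circle_measure. X (of_real (1 - \<epsilon>) * z) * cnj z ^ n)
        \<longlongrightarrow> (LINT z|circle_measure. Y z * cnj z ^ n)) (at_right 0)"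
      by (intro has_L2_boundary_value_tendsto Y continuous_intros) (simp add: norm_power)
    ultimately show ?thesis
      using tendsto_unique trivial_limit_at_right_real by fastforce
  qed
  have neg: "(LINT z|circle_measure. Y z * z ^ Suc n) = 0" for n
  proof -
    have "\<forall>\<^sub>F \<epsilon> in at_right 0. 0 = (LINT z|circle_measure. X (of_real (1 - \<epsilon>) * z) * z ^ Suc n)"
      using eventually_at_right_0_1
      by eventually_elim (subst circle_Fourier_neg[OF assms(1)], auto)
    then have "((\<lambda>\<epsilon>. LINT z|circle_measure. X (of_real (1 - \<epsilon>) * z) * z ^ Suc n) \<longlongrightarrow> 0) (at_right 0)"
      by (rule Lim_transform_eventually[OF tendsto_const])
    moreover have "((\<lambda>\<epsilon>. LINT z|circle_measure. X (of_real (1 - \<epsilon>) * z) * z ^ Suc n)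
        \<longlongrightarrow> (LINT z|circle_measure. Y z * z ^ Suc n)) (at_right 0)"
      by (intro has_L2_boundary_value_tendsto Y continuous_intros)
        (simp only: norm_power, simp)
    ultimately show ?thesis
      using tendsto_unique trivial_limit_at_right_real by blast
  qed
  have "Y \<in> borel_measurable circle_measure"
    using Y(1) unfolding has_L2_boundary_value_def by blast
  note mom = tangential_moments[OF this Y(2)]
  show ?thesis
  proof (rule holomorphic_quadratic[OF assms(1) a_def])
    show "a (Suc (Suc (Suc k))) = 0" for k
      \<comment> \<open>From the shift to \<open>Suc k\<close> on, the mirrored coefficient has
        negative index and vanishes.\<close>
      using mom(1)[of "Suc k"] unfolding pos neg by simp
    have "of_real pi * a (Suc (Suc 0)) = - (of_real pi * cnj (a 0))"
      using mom(1)[of 0] pos[of 0] pos[of "Suc (Suc 0)"] by simp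
    then show "a (Suc (Suc 0)) = - cnj (a 0)"
      by (simp add: mult_eq_minus_mult_iff)
    show "a 1 = - cnj (a 1)"
      using mom(2) unfolding pos by (simp add: mult_eq_minus_mult_iff)
  qed
qed

lemma quadratic_extends_tangentially:
  assumes "\<And>z. z \<in> disc \<Longrightarrow> X z = c + \<i> * of_real b * z - cnj c * z\<^sup>2"
  shows "extends_tangentially X"
  unfolding extends_tangentially_def
proof (intro exI conjI)
  define Y where "Y = (\<lambda>z. c + \<i> * of_real b * z - cnj c * z\<^sup>2)"
  show "has_L2_boundary_value X Y"
  proof (rule has_L2_boundary_valueI)
    have "continuous_on disc Y" unfolding Y_def by (intro continuous_intros)
    then show "continuous_on disc X"
      by (rule continuous_on_eq) (simp add: Y_def assms)
    fix z :: complex and \<epsilon> :: real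
    assume z: "z \<in> sphere 0 1" and \<epsilon>: "0 < \<epsilon>" "\<epsilon> < 1"
    have "of_real (1 - \<epsilon>) * z \<in> disc" using z \<epsilon> by (simp add: norm_mult del: of_real_diff)
    then have "X (of_real (1 - \<epsilon>) * z) - Y z
        = of_real \<epsilon> * (cnj c * (of_real (2 - \<epsilon>) * z\<^sup>2) - \<i> * of_real b * z)"
      by (simp add: assms Y_def power2_eq_square algebra_simps)
    also have "norm \<dots> \<le> \<epsilon> * (norm c * 2 + \<bar>b\<bar>)"
    proof -
      have "norm (cnj c * (of_real (2 - \<epsilon>) * z\<^sup>2) - \<i> * of_real b * z)
          \<le> norm (cnj c * (of_real (2 - \<epsilon>) * z\<^sup>2)) + norm (\<i> * of_real b * z)"
        by (rule norm_triangle_ineq4)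
      also have "\<dots> = norm c * (2 - \<epsilon>) + \<bar>b\<bar>"
        using z \<epsilon> by (simp add: norm_mult norm_power del: of_real_diff)
      also have "\<dots> \<le> norm c * 2 + \<bar>b\<bar>"
        using \<epsilon> by (simp add: mult_left_mono)
      finally show ?thesis using \<epsilon> by (simp add: norm_mult mult_left_mono)
    qed
    also have "\<dots> \<le> sqrt \<epsilon> * (norm c * 2 + \<bar>b\<bar>)"
    proof (rule mult_right_mono)
      \<comment> \<open>The error is linear in \<epsilon>; it is weakened to the rate of
        \<open>has_L2_boundary_valueI\<close>.\<close>
      have "\<epsilon>\<^sup>2 \<le> \<epsilon>" using \<epsilon> by (simp add: power2_eq_square)
      then show "\<epsilon> \<le> sqrt \<epsilon>" by (rule real_le_rsqrt)
    qed simp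
    finally show "norm (X (of_real (1 - \<epsilon>) * z) - Y z) \<le> (norm c * 2 + \<bar>b\<bar>) * sqrt \<epsilon>"
      by (simp add: mult.commute)
  qed
  \<comment> \<open>As z cnj z = 1, the part c - cnj c z^2 equals z (cnj z c - z cnj c), and the
    bracket is 2 i Im (cnj z c).\<close>
  have "Y z = of_real (b + 2 * Im (cnj z * c)) * (\<i> * z)" if "z \<in> sphere 0 1" for z
  proof -
    have z: "z * cnj z = 1" using that complex_norm_square[of z] by simp
    have "of_real (b + 2 * Im (cnj z * c)) * (\<i> * z)
        = \<i> * of_real b * z + z * (\<i> * of_real (2 * Im (cnj z * c)))"
      by (simp add: algebra_simps)
    also have "\<i> * of_real (2 * Im (cnj z * c)) = cnj z * c - z * cnj c"
      by (simp add: complex_eq_iff algebra_simps)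
    also have "\<i> * of_real b * z + z * (cnj z * c - z * cnj c) = \<i> * of_real b * z + (z * cnj z) * c - cnj c * z\<^sup>2"
      by (simp add: algebra_simps power2_eq_square)
    finally show ?thesis by (simp add: z Y_def)
  qed
  then show "tangential Y"
    unfolding tangential_def by (intro exI[of _ "\<lambda>z. b + 2 * Im (cnj z * c)"] AE_I2) simp
qed

text \<open>On the circle of radius \<open>1/2\<close> the hypothesis says that \<open>2 r\<^sup>2 X + (1 - r\<^sup>2) z X'\<close> is tangential,
  so the moment relations apply to it; each Taylor coefficient of it is a positive multiple of that of \<open>X\<close>.\<close>

lemma infinitesimal_isometry_quadratic:
  assumes X: "X holomorphic_on disc"
    and isom: "\<And>z. z \<in> disc \<Longrightarrow> 2 * (z \<bullet> X z) + (1 - (norm z)\<^sup>2) * Re (deriv X z) = 0"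
  shows "\<exists>c b. \<forall>z\<in>disc. X z = c + \<i> * of_real b * z - cnj c * z\<^sup>2"
proof -
  \<comment> \<open>Any radius strictly between 0 and 1 would serve.\<close>
  define r :: real where "r = 1 / 2"
  have r: "0 < r" "r < 1" by (simp_all add: r_def)
  define a where "a n = (deriv ^^ n) X 0 / fact n" for n
  have X': "deriv X holomorphic_on disc" by (rule holomorphic_deriv[OF X open_ball])
  define p where "p = (\<lambda>z. X (of_real r * z))"
  define p' where "p' = (\<lambda>z. deriv X (of_real r * z))"
  have cont: "continuous_on (sphere 0 1) p" "continuous_on (sphere 0 1) p'"
    unfolding p_def p'_def using r
    by (auto intro: continuous_on_circle_dilate X[THEN holomorphic_on_imp_continuous_on]
        X'[THEN holomorphic_on_imp_continuous_on])
  have I: "(LINT z|circle_measure. p z * cnj z ^ n) = 2 * pi * a n * of_real r ^ n" for n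
    unfolding p_def by (subst circle_Fourier_nonneg[OF X r]) (simp add: a_def)
  have I': "(LINT z|circle_measure. p' z * cnj z ^ n) = 2 * pi * (of_nat (Suc n) * a (Suc n)) * of_real r ^ n" for n
    unfolding p'_def
    by (subst circle_Fourier_nonneg[OF X' r]) (simp add: a_def funpow_Suc_right del: funpow.simps of_nat_Suc)
  have N: "(LINT z|circle_measure. p z * z ^ Suc n) = 0" "(LINT z|circle_measure. p' z * z ^ Suc n) = 0" for n
    unfolding p_def p'_def by (rule circle_Fourier_neg[OF X r] circle_Fourier_neg[OF X' r]; simp)+
  \<comment> \<open>The field 2 r^2 X + (1 - r^2) z X' at the point r z: its radial component is
    \<open>r\<close> times the expression that \<open>isom\<close> makes zero.\<close>
  define Y where "Y = (\<lambda>z. of_real (2 * r\<^sup>2) * p z + of_real ((1 - r\<^sup>2) * r) * (z * p' z))"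
  have unit: "z * cnj z = 1" if "z \<in> sphere 0 1" for z
    using that complex_norm_square[of z] by simp
  have Ymeas: "Y \<in> borel_measurable circle_measure"
    unfolding Y_def by (intro circle_measurable_continuous continuous_intros cont)
  have "Y z = of_real (Im (cnj z * Y z)) * (\<i> * z)" if z: "z \<in> sphere 0 1" for z
  proof -
    have rz: "of_real r * z \<in> disc" "norm (of_real r * z) = r" using z r by (simp_all add: norm_mult)
    have "Re (cnj z * Y z) = 2 * r\<^sup>2 * Re (cnj z * p z) + (1 - r\<^sup>2) * r * Re ((z * cnj z) * p' z)"
      by (simp add: Y_def algebra_simps)
    also have "\<dots> = r * (2 * ((of_real r * z) \<bullet> p z) + (1 - r\<^sup>2) * Re (p' z))"
      unfolding unit[OF z] by (simp add: inner_complex_def algebra_simps power2_eq_square)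
    also have "\<dots> = 0"
      using isom[OF rz(1)] rz(2) by (simp add: p_def p'_def)
    finally have "cnj z * Y z = \<i> * of_real (Im (cnj z * Y z))"
      by (simp add: complex_eq_iff)
    then have "z * (cnj z * Y z) = z * (\<i> * of_real (Im (cnj z * Y z)))" by simp
    then show ?thesis using unit[OF z] by (metis mult.assoc mult.commute mult_1)
  qed
  then have "tangential Y"
    unfolding tangential_def by (intro exI[of _ "\<lambda>z. Im (cnj z * Y z)"] AE_I2) simp
  note mom = tangential_moments[OF Ymeas this]
  \<comment> \<open>The factor z in front of \<open>p'\<close> is moved into the weight, which
    shifts the index of that Fourier coefficient by one.\<close>
  have split: "(LINT z|circle_measure. Y z * w z)
      = of_real (2 * r\<^sup>2) * (LINT z|circle_measure. p z * w z)
      + of_real ((1 - r\<^sup>2) * r) * (LINT z|circle_measure. p' z * w' z)"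
    if w: "continuous_on (sphere 0 1) w" and w': "continuous_on (sphere 0 1) w'"
      and ww': "\<And>z. z \<in> sphere 0 1 \<Longrightarrow> z * w z = w' z" for w w'
  proof -
    have "(LINT z|circle_measure. Y z * w z) = (LINT z|circle_measure.
        of_real (2 * r\<^sup>2) * (p z * w z) + of_real ((1 - r\<^sup>2) * r) * (p' z * w' z))"
      by (rule Bochner_Integration.integral_cong) (auto simp: Y_def algebra_simps simp flip: ww')
    also have "\<dots> = of_real (2 * r\<^sup>2) * (LINT z|circle_measure. p z * w z)
      + of_real ((1 - r\<^sup>2) * r) * (LINT z|circle_measure. p' z * w' z)"
      by (subst Bochner_Integration.integral_add)
        (intro circle_integrable_continuous continuous_intros cont w w' integral_mult_right_zero
          | simp only: integral_mult_right_zero)+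
    finally show ?thesis .
  qed
  \<comment> \<open>Differentiation contributes the factor n + 1, so both summands are nonnegative
    multiples of the same Taylor coefficient and cannot cancel.\<close>
  have P: "(LINT z|circle_measure. Y z * cnj z ^ Suc n)
      = 2 * pi * of_real (r ^ Suc n * (2 * r\<^sup>2 + (1 - r\<^sup>2) * real (Suc n))) * a (Suc n)" for n
  proof -
    have "(LINT z|circle_measure. Y z * cnj z ^ Suc n)
      = of_real (2 * r\<^sup>2) * (LINT z|circle_measure. p z * cnj z ^ Suc n)
      + of_real ((1 - r\<^sup>2) * r) * (LINT z|circle_measure. p' z * cnj z ^ n)"
      by (rule split) (auto intro!: continuous_intros simp: unit simp flip: mult.assoc)
    then show ?thesis unfolding I I' by (simp add: algebra_simps)
  qed
  have P0: "(LINT z|circle_measure. Y z * z ^ 0) = 2 * pi * of_real (2 * r\<^sup>2) * a 0"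
  proof -
    have "(LINT z|circle_measure. Y z * z ^ 0)
      = of_real (2 * r\<^sup>2) * (LINT z|circle_measure. p z * z ^ 0)
      + of_real ((1 - r\<^sup>2) * r) * (LINT z|circle_measure. p' z * z ^ Suc 0)"
      by (rule split) (auto intro!: continuous_intros)
    then show ?thesis using I[of 0] N(2)[of 0] by (simp add: mult_ac)
  qed
  have Pneg: "(LINT z|circle_measure. Y z * z ^ Suc n) = 0" for n
  proof -
    have "(LINT z|circle_measure. Y z * z ^ Suc n)
      = of_real (2 * r\<^sup>2) * (LINT z|circle_measure. p z * z ^ Suc n)
      + of_real ((1 - r\<^sup>2) * r) * (LINT z|circle_measure. p' z * z ^ Suc (Suc n))"
      by (rule split) (auto intro!: continuous_intros)
    then show ?thesis unfolding N by simp
  qed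
  show ?thesis
  proof (rule holomorphic_quadratic[OF X a_def])
    fix k
    define q where "q = r ^ Suc (Suc (Suc k)) * (2 * r\<^sup>2 + (1 - r\<^sup>2) * real (Suc (Suc (Suc k))))"
    have "q > 0"
      unfolding q_def by (intro mult_pos_pos add_pos_pos zero_less_power) (simp_all add: r_def power2_eq_square)
    then show "a (Suc (Suc (Suc k))) = 0"
      using mom(1)[of "Suc k"] unfolding P Pneg q_def[symmetric] by simp
  next
    show "a (Suc (Suc 0)) = - cnj (a 0)"
      using mom(1)[of 0] unfolding P P0 by (simp add: r_def power2_eq_square mult_eq_minus_mult_iff)
    show "a 1 = - cnj (a 1)"
      using mom(2) unfolding One_nat_def P by (simp add: r_def power2_eq_square mult_eq_minus_mult_iff)
  qed
qed

section \<open>Growth estimates\<close>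

text \<open>Mean value inequality along a radius: \<open>\<Psi>\<close> is a primitive of the radial
  majorant \<open>\<psi>\<close> of the derivative.\<close>

lemma radial_growth:
  assumes g: "\<And>z. z \<in> disc \<Longrightarrow> (g has_field_derivative g' z) (at z)"
    and bound: "\<And>z. z \<in> disc \<Longrightarrow> norm (g' z) \<le> \<psi> (norm z)"
    and \<Psi>: "\<And>s. 0 \<le> s \<Longrightarrow> s < 1 \<Longrightarrow> (\<Psi> has_real_derivative \<psi> s) (at s)"
    and s: "0 \<le> s" "s \<le> t" "t < 1" and u: "norm u = 1"
  shows "norm (g (of_real t * u) - g (of_real s * u)) \<le> \<Psi> t - \<Psi> s"
proof (cases "s = t")
  case False
  have in_disc: "of_real x * u \<in> disc" if "x \<in> {s..t}" for x
    using that s u by (simp add: norm_mult)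
  have d: "((\<lambda>x. g (of_real x * u)) has_vector_derivative (g' (of_real x * u) * u)) (at x)"
    if "x \<in> {s..t}" for x
  proof -
    have "((\<lambda>x. of_real x * u) has_vector_derivative u) (at x)"
      by (auto simp: has_vector_derivative_def scaleR_conv_of_real intro!: derivative_eq_intros)
    from field_vector_diff_chain_at[OF this g[OF in_disc[OF that]]] show ?thesis
      by (simp add: o_def mult.commute)
  qed
  have d\<Psi>: "(\<Psi> has_vector_derivative \<psi> x) (at x)" if "x \<in> {s..t}" for x
    using \<Psi>[of x] that s by (simp add: has_real_derivative_iff_has_vector_derivative)
  show ?thesis
  proof (rule differentiable_bound_general[where f = "\<lambda>x. g (of_real x * u)"])
    show "continuous_on {s..t} (\<lambda>x. g (of_real x * u))"
      using d by (intro continuous_at_imp_continuous_on) (blast intro: has_vector_derivative_continuous)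
    show "continuous_on {s..t} \<Psi>"
      using d\<Psi> by (intro continuous_at_imp_continuous_on) (blast intro: has_vector_derivative_continuous)
    show "norm (g' (of_real x * u) * u) \<le> \<psi> x" if "s < x" "x < t" for x
      using bound[OF in_disc[of x]] that s u by (simp add: norm_mult)
  qed (use False s d d\<Psi> in auto)
qed simp

lemma disc_growth:
  assumes g: "\<And>z. z \<in> disc \<Longrightarrow> (g has_field_derivative g' z) (at z)"
    and bound: "\<And>z. z \<in> disc \<Longrightarrow> norm (g' z) \<le> \<psi> (norm z)"
    and \<Psi>: "\<And>s. 0 \<le> s \<Longrightarrow> s < 1 \<Longrightarrow> (\<Psi> has_real_derivative \<psi> s) (at s)"
    and z: "z \<in> disc"
  shows "norm (g z) \<le> norm (g 0) + (\<Psi> (norm z) - \<Psi> 0)"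
proof -
  \<comment> \<open>The direction of \<open>z\<close>; at the origin any unit vector will
    do.\<close>
  define u where "u = (if z = 0 then 1 else sgn z)"
  have u: "norm u = 1" "of_real (norm z) * u = z"
    by (simp_all add: u_def norm_mult norm_inverse sgn_div_norm scaleR_conv_of_real)
  have "norm (g z - g 0) \<le> \<Psi> (norm z) - \<Psi> 0"
    using radial_growth[OF g bound \<Psi>, of 0 "norm z" u] z u by simp
  then show ?thesis
    using norm_triangle_ineq2[of "g z" "g 0"] by linarith
qed

text \<open>The hypothesis is a Cauchy condition along each radius. Letting \<open>t\<close> tend to
  1 with s = 1 - \<epsilon> fixed keeps the rate, with a constant independent of the
  direction.\<close>

lemma radial_limit:
  fixes G :: "complex \<Rightarrow> complex"
  assumes G: "\<And>s t u. 0 \<le> s \<Longrightarrow> s \<le> t \<Longrightarrow> t < 1 \<Longrightarrow> norm u = 1 \<Longrightarrow>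
      norm (G (of_real t * u) - G (of_real s * u)) \<le> c * sqrt (1 - s)"
  shows "\<exists>L. \<forall>u \<epsilon>. norm u = 1 \<longrightarrow> 0 < \<epsilon> \<longrightarrow> \<epsilon> < 1 \<longrightarrow>
      norm (G (of_real (1 - \<epsilon>) * u) - L u) \<le> c * sqrt \<epsilon>"
proof -
  define t where "t n = 1 - 1 / real (Suc n)" for n
  have t: "0 \<le> t n" "t n < 1" for n by (simp_all add: t_def)
  have t_mono: "t m \<le> t n" if "m \<le> n" for m n
    using that by (simp add: t_def frac_le)
  have t_lim: "t \<longlonglongrightarrow> 1"
    using tendsto_diff[OF tendsto_const[of 1] LIMSEQ_inverse_real_of_nat]
    by (simp add: t_def[abs_def] inverse_eq_divide)
  have "\<exists>l. \<forall>\<epsilon>. 0 < \<epsilon> \<longrightarrow> \<epsilon> < 1 \<longrightarrow> norm (G (of_real (1 - \<epsilon>) * u) - l) \<le> c * sqrt \<epsilon>" if u: "norm u = 1" for u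
  proof -
    define x where "x n = G (of_real (t n) * u)" for n
    have "Cauchy x"
    proof (rule metric_CauchyI)
      fix e :: real assume "0 < e"
      have "(\<lambda>n. c * sqrt (1 - t n)) \<longlonglongrightarrow> c * sqrt (1 - 1)"
        by (intro tendsto_intros t_lim)
      then have "\<forall>\<^sub>F n in sequentially. c * sqrt (1 - t n) < e / 2"
        using \<open>0 < e\<close> by (intro order_tendstoD) auto
      then obtain M where M: "c * sqrt (1 - t M) < e / 2"
        using eventually_happens'[OF sequentially_bot] by blast
      have near: "dist (x n) (x M) < e / 2" if "n \<ge> M" for n
        using G[OF t(1) t_mono[OF that] t(2) u] M by (simp add: x_def dist_norm)
      have "dist (x m) (x n) < e" if "m \<ge> M" "n \<ge> M" for m n
        using near[OF that(1)] near[OF that(2)] dist_triangle2[of "x m" "x n" "x M"] by linarith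
      then show "\<exists>M. \<forall>m\<ge>M. \<forall>n\<ge>M. dist (x m) (x n) < e" by blast
    qed
    then obtain l where l: "x \<longlonglongrightarrow> l"
      using Cauchy_convergent convergent_def by blast
    have "norm (G (of_real (1 - \<epsilon>) * u) - l) \<le> c * sqrt \<epsilon>" if \<epsilon>: "0 < \<epsilon>" "\<epsilon> < 1" for \<epsilon>
    proof (rule tendsto_upperbound)
      show "(\<lambda>n. norm (G (of_real (1 - \<epsilon>) * u) - x n)) \<longlonglongrightarrow> norm (G (of_real (1 - \<epsilon>) * u) - l)"
        by (intro tendsto_intros l)
      have "\<forall>\<^sub>F n in sequentially. 1 - \<epsilon> < t n"
        using \<epsilon> by (intro order_tendstoD(1)[OF t_lim]) simp
      then show "\<forall>\<^sub>F n in sequentially. norm (G (of_real (1 - \<epsilon>) * u) - x n) \<le> c * sqrt \<epsilon>"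
      proof eventually_elim
        case (elim n)
        have "norm (x n - G (of_real (1 - \<epsilon>) * u)) \<le> c * sqrt (1 - (1 - \<epsilon>))"
          unfolding x_def using elim \<epsilon> t(2)[of n] u by (intro G) auto
        then show ?case by (simp add: norm_minus_commute)
      qed
    qed simp
    then show ?thesis by blast
  qed
  then show ?thesis by metis
qed

lemma holomorphic_disc_primitive:
  assumes "f holomorphic_on disc"
  obtains g where "\<And>z. z \<in> disc \<Longrightarrow> (g has_field_derivative f z) (at z)"
proof -
  obtain g where g: "\<And>z. z \<in> disc \<Longrightarrow> (g has_field_derivative f z) (at z within disc)"
    using holomorphic_convex_primitive'[OF convex_ball open_ball assms] by blast
  have "(g has_field_derivative f z) (at z)" if "z \<in> disc" for z
    using g[OF that] at_within_open[OF that open_ball] by metis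
  then show thesis by (rule that)
qed

section \<open>Existence and uniqueness\<close>

text \<open>With \<open>f = G'''\<close> the solution extends continuously to the circle, with boundary value
  \<open>(z\<^sup>2 cnj G - G) / 4 = i z Im (z cnj G) / 2\<close>.\<close>

lemma tangential_solution_exists:
  assumes f: "f holomorphic_on disc"
    and M: "\<And>z. z \<in> disc \<Longrightarrow> norm (f z) \<le> M / (1 - norm z)\<^sup>2"
  shows "\<exists>\<eta>. tangential_solution f \<eta>"
proof -
  obtain G2 where G2: "\<And>z. z \<in> disc \<Longrightarrow> (G2 has_field_derivative f z) (at z)"
    using holomorphic_disc_primitive[OF f] by blast
  then have "G2 holomorphic_on disc" using holomorphic_on_open[OF open_ball] by blast
  then obtain G1 where G1: "\<And>z. z \<in> disc \<Longrightarrow> (G1 has_field_derivative G2 z) (at z)"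
    using holomorphic_disc_primitive by blast
  then have "G1 holomorphic_on disc" using holomorphic_on_open[OF open_ball] by blast
  then obtain G where G: "\<And>z. z \<in> disc \<Longrightarrow> (G has_field_derivative G1 z) (at z)"
    using holomorphic_disc_primitive by blast
  then have holG: "G holomorphic_on disc" using holomorphic_on_open[OF open_ball] by blast
  have "0 \<le> M" using order_trans[OF norm_ge_zero M[of 0]] by simp
  \<comment> \<open>Integrating M / (1 - s)^2 gives M / (1 - s) - M; the value at 0 is absorbed
    because 1 \<le> 1 / (1 - |z|).\<close>
  define C2 where "C2 = norm (G2 0) + M"
  have C2: "norm (G2 z) \<le> C2 / (1 - norm z)" "0 \<le> C2" if z: "z \<in> disc" for z
  proof -
    show C2: "0 \<le> C2" using \<open>0 \<le> M\<close> by (simp add: C2_def)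
    have pos: "0 < 1 - norm z" "1 - norm z \<le> 1" using z by simp_all
    have "norm (G2 z) \<le> norm (G2 0) + (M / (1 - norm z) - M / (1 - 0))"
    proof (rule disc_growth[OF G2 M _ z])
      show "((\<lambda>s. M / (1 - s)) has_real_derivative M / (1 - s)\<^sup>2) (at s)" if "0 \<le> s" "s < 1" for s
        using that by (auto intro!: derivative_eq_intros simp: power2_eq_square)
    qed
    also have "\<dots> \<le> norm (G2 0) / (1 - norm z) + M / (1 - norm z)"
      using mult_left_le[OF pos(2) norm_ge_zero[of "G2 0"]] pos(1) \<open>0 \<le> M\<close>
      by (intro add_mono) (simp add: pos_le_divide_eq, simp)
    finally show "norm (G2 z) \<le> C2 / (1 - norm z)" by (simp add: C2_def add_divide_distrib)
  qed
  have C2_0: "0 \<le> C2" using C2(2)[of 0] by simp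
  define C1 where "C1 = norm (G1 0) + 2 * C2"
  have C1_0: "0 \<le> C1" using C2_0 by (simp add: C1_def)
  have C1: "norm (G1 z) \<le> C1 / sqrt (1 - norm z)" if z: "z \<in> disc" for z
  proof -
    have pos: "0 < sqrt (1 - norm z)" "sqrt (1 - norm z) \<le> 1" using z by simp_all
    have "norm (G1 z) \<le> norm (G1 0) + (2 * C2 / sqrt (1 - norm z) - 2 * C2 / sqrt (1 - 0))"
    proof (rule disc_growth[OF G1 _ _ z])
      \<comment> \<open>Weakening the exponent from 1 to 3/2 avoids a logarithm: the primitive is
        then 2 C2 / sqrt (1 - s).\<close>
      show "norm (G2 w) \<le> C2 / ((1 - norm w) * sqrt (1 - norm w))" if "w \<in> disc" for w
      proof -
        have "C2 / (1 - norm w) \<le> C2 / ((1 - norm w) * sqrt (1 - norm w))"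
          using that C2_0 by (intro divide_left_mono) (auto simp: mult_left_le)
        then show ?thesis using C2(1)[OF that] by linarith
      qed
      show "((\<lambda>s. 2 * C2 / sqrt (1 - s)) has_real_derivative C2 / ((1 - s) * sqrt (1 - s))) (at s)"
        if "0 \<le> s" "s < 1" for s
        using that by (auto intro!: derivative_eq_intros simp: field_simps)
    qed
    also have "\<dots> \<le> norm (G1 0) / sqrt (1 - norm z) + 2 * C2 / sqrt (1 - norm z)"
      using mult_left_le[OF pos(2) norm_ge_zero[of "G1 0"]] pos(1) C2_0
      by (intro add_mono) (simp add: pos_le_divide_eq, simp)
    finally show ?thesis by (simp add: C1_def add_divide_distrib)
  qed
  have dsqrt: "((\<lambda>s. - 2 * C1 * sqrt (1 - s)) has_real_derivative C1 / sqrt (1 - s)) (at s)"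
    if "0 \<le> s" "s < 1" for s
    using that by (auto intro!: derivative_eq_intros simp: field_simps)
  have "norm (G (of_real t * u) - G (of_real s * u)) \<le> 2 * C1 * sqrt (1 - s)"
    if "0 \<le> s" "s \<le> t" "t < 1" "norm u = 1" for s t u
  proof -
    have "norm (G (of_real t * u) - G (of_real s * u)) \<le> - 2 * C1 * sqrt (1 - t) - - 2 * C1 * sqrt (1 - s)"
      by (rule radial_growth[OF G C1 dsqrt that])
    moreover have "0 \<le> C1 * sqrt (1 - t)" using C1_0 that by simp
    ultimately show ?thesis by simp
  qed
  from radial_limit[of G, OF this]
  obtain L where L: "\<And>u \<epsilon>. norm u = 1 \<Longrightarrow> 0 < \<epsilon> \<Longrightarrow> \<epsilon> < 1 \<Longrightarrow>
      norm (G (of_real (1 - \<epsilon>) * u) - L u) \<le> 2 * C1 * sqrt \<epsilon>"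
    by blast
  define C0 where "C0 = norm (G 0) + 2 * C1"
  have C0: "norm (G z) \<le> C0" if z: "z \<in> disc" for z
  proof -
    have "norm (G z) \<le> norm (G 0) + (- 2 * C1 * sqrt (1 - norm z) - - 2 * C1 * sqrt (1 - 0))"
      by (rule disc_growth[OF G C1 dsqrt z])
    moreover have "0 \<le> C1 * sqrt (1 - norm z)" using C1_0 z by simp
    ultimately show ?thesis by (simp add: C0_def)
  qed
  \<comment> \<open>Repeated integration by parts expresses the primitives of f / 8, z f / 8 and z^2
    f / 8 through \<open>G2\<close>, \<open>G1\<close> and \<open>G\<close>.\<close>
  define A where "A = (\<lambda>z. G2 z / 8)"
  define B where "B = (\<lambda>z. (z * G2 z - G1 z) / 8)"
  define C where "C = (\<lambda>z. (z\<^sup>2 * G2 z - 2 * z * G1 z + 2 * G z) / 8)"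
  \<comment> \<open>The free holomorphic summand is chosen as - G / 4 to balance the term z^2 cnj G
    / 4, which alone would not be tangential.\<close>
  define \<eta> where "\<eta> = (\<lambda>z. cnj (A z) - 2 * z * cnj (B z) + z\<^sup>2 * cnj (C z) + - G z / 4)"
  have A: "(A has_field_derivative f z / 8) (at z)" if "z \<in> disc" for z
    unfolding A_def by (auto intro!: derivative_eq_intros G2[OF that])
  have B: "(B has_field_derivative z * f z / 8) (at z)" if "z \<in> disc" for z
    unfolding B_def by (auto intro!: derivative_eq_intros G2[OF that] G1[OF that])
  have C: "(C has_field_derivative z\<^sup>2 * f z / 8) (at z)" if "z \<in> disc" for z
    unfolding C_def
    by (auto intro!: derivative_eq_intros G2[OF that] G1[OF that] G[OF that] simp: algebra_simps)
  have "(\<lambda>z. - G z / 4) holomorphic_on disc"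
    by (intro holomorphic_intros holG) simp
  note sol = prescribed_lie20[OF f A B C this, of \<eta>, unfolded \<eta>_def, OF _ _ _ refl, folded \<eta>_def]
  have \<eta>: "\<eta> z = ((of_real (1 - (norm z)\<^sup>2))\<^sup>2 * cnj (G2 z)
      + 2 * z * of_real (1 - (norm z)\<^sup>2) * cnj (G1 z)) / 8 + (z\<^sup>2 * cnj (G z) - G z) / 4" for z
    unfolding \<eta>_def A_def B_def C_def of_real_diff of_real_1 complex_norm_square
    by (simp add: power2_eq_square field_simps)
  define Y where "Y = (\<lambda>u. (u\<^sup>2 * cnj (L u) - L u) / 4)"
  have "has_L2_boundary_value \<eta> Y"
  proof (rule has_L2_boundary_valueI)
    have "smooth_on disc \<eta>" using sol(1) by (simp add: harmonic_vf_def)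
    then show "continuous_on disc \<eta>"
      unfolding smooth_on_def by (metis Ck_on.simps(1))
    fix u :: complex and \<epsilon> :: real
    assume u: "u \<in> sphere 0 1" and \<epsilon>: "0 < \<epsilon>" "\<epsilon> < 1"
    define z where "z = of_real (1 - \<epsilon>) * u"
    have nz: "norm z = 1 - \<epsilon>" using u \<epsilon> by (simp add: z_def norm_mult del: of_real_diff)
    then have z: "z \<in> disc" using \<epsilon> by simp
    define s where "s = 1 - (norm z)\<^sup>2"
    \<comment> \<open>Since \<open>s\<close> vanishes linearly at the circle, s^2 outweighs the
      growth C2 / \<epsilon> of \<open>G2\<close> and \<open>s\<close> outweighs C1 / sqrt
      \<epsilon> for \<open>G1\<close>.\<close>
    have s: "0 \<le> s" "s \<le> 2 * \<epsilon>"
      using \<epsilon> by (simp_all add: s_def nz power2_eq_square algebra_simps)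
    have sq: "\<epsilon> \<le> sqrt \<epsilon>" "sqrt \<epsilon> * sqrt \<epsilon> = \<epsilon>"
      using \<epsilon> by (auto intro!: real_le_rsqrt simp: power2_eq_square)
    have 1: "norm ((of_real s)\<^sup>2 * cnj (G2 z)) \<le> 4 * C2 * sqrt \<epsilon>"
    proof -
      have "norm ((of_real s)\<^sup>2 * cnj (G2 z)) = s\<^sup>2 * norm (G2 z)"
        by (simp add: norm_mult norm_power)
      also have "\<dots> \<le> (2 * \<epsilon>)\<^sup>2 * (C2 / \<epsilon>)"
        using C2(1)[OF z] s nz by (intro mult_mono power_mono) auto
      also have "\<dots> = 4 * C2 * \<epsilon>" using \<epsilon> by (simp add: power2_eq_square)
      also have "\<dots> \<le> 4 * C2 * sqrt \<epsilon>" using sq C2_0 by (simp add: mult_left_mono)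
      finally show ?thesis .
    qed
    have 2: "norm (2 * z * of_real s * cnj (G1 z)) \<le> 4 * C1 * sqrt \<epsilon>"
    proof -
      have "norm (2 * z * of_real s * cnj (G1 z)) = 2 * norm z * s * norm (G1 z)"
        using s by (simp add: norm_mult)
      also have "\<dots> \<le> 2 * 1 * (2 * \<epsilon>) * (C1 / sqrt \<epsilon>)"
        using C1[OF z] s nz \<epsilon> by (intro mult_mono) auto
      also have "\<dots> = 4 * C1 * sqrt \<epsilon>"
        using \<epsilon> sq(2) by (simp add: field_simps)
      finally show ?thesis .
    qed
    have GL: "norm (G z - L u) \<le> 2 * C1 * sqrt \<epsilon>"
      unfolding z_def using L u \<epsilon> by simp
    have 3: "norm (z\<^sup>2 * cnj (G z) - u\<^sup>2 * cnj (L u)) \<le> 2 * C0 * sqrt \<epsilon> + 2 * C1 * sqrt \<epsilon>"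
    proof -
      \<comment> \<open>As z is the multiple (1 - \<epsilon>) u, one has z^2 = (1 - s) u^2.\<close>
      have "z\<^sup>2 * cnj (G z) - u\<^sup>2 * cnj (L u) = u\<^sup>2 * (cnj (G z - L u) - of_real s * cnj (G z))"
        unfolding s_def nz by (simp add: z_def power2_eq_square algebra_simps)
      also have "norm \<dots> = norm (cnj (G z - L u) - of_real s * cnj (G z))"
        using u by (simp add: norm_mult norm_power)
      also have "\<dots> \<le> norm (cnj (G z - L u)) + norm (of_real s * cnj (G z))"
        by (rule norm_triangle_ineq4)
      also have "norm (of_real s * cnj (G z)) \<le> (2 * sqrt \<epsilon>) * C0"
        unfolding norm_mult using s sq C0[OF z] \<epsilon> by (intro mult_mono) auto
      finally show ?thesis using GL by (simp add: mult_ac del: complex_cnj_diff)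
    qed
    have "\<eta> z - Y u = (of_real s)\<^sup>2 * cnj (G2 z) / 8 + 2 * z * of_real s * cnj (G1 z) / 8
        + ((z\<^sup>2 * cnj (G z) - u\<^sup>2 * cnj (L u)) / 4 - (G z - L u) / 4)"
      unfolding \<eta> Y_def s_def by (simp add: add_divide_distrib diff_divide_distrib)
    also have "norm \<dots> \<le> norm ((of_real s)\<^sup>2 * cnj (G2 z) / 8) + norm (2 * z * of_real s * cnj (G1 z) / 8)
        + (norm ((z\<^sup>2 * cnj (G z) - u\<^sup>2 * cnj (L u)) / 4) + norm ((G z - L u) / 4))"
      by (intro norm_triangle_mono norm_triangle_le_diff order_refl)
    also have "\<dots> \<le> 4 * C2 * sqrt \<epsilon> / 8 + 4 * C1 * sqrt \<epsilon> / 8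
        + ((2 * C0 * sqrt \<epsilon> + 2 * C1 * sqrt \<epsilon>) / 4 + 2 * C1 * sqrt \<epsilon> / 4)"
      unfolding norm_divide norm_numeral
      by (intro add_mono divide_right_mono 1 2 3 GL) simp_all
    also have "\<dots> = (C2 / 2 + 3 * C1 / 2 + C0 / 2) * sqrt \<epsilon>"
      by (simp add: field_simps)
    finally show "norm (\<eta> (of_real (1 - \<epsilon>) * u) - Y u) \<le> (C2 / 2 + 3 * C1 / 2 + C0 / 2) * sqrt \<epsilon>"
      by (simp add: z_def)
  qed
  moreover have "tangential Y"
    unfolding tangential_def
  proof (intro exI[of _ "\<lambda>u. Im (u * cnj (L u)) / 2"] AE_I2)
    fix u assume "u \<in> space circle_measure"
    then have u: "u * cnj u = 1" using complex_norm_square[of u] by simp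
    have "of_real (Im (u * cnj (L u)) / 2) * (\<i> * u) = (u * (u * cnj (L u) - cnj u * L u)) / 4"
      by (simp add: complex_eq_iff field_simps)
    also have "\<dots> = (u\<^sup>2 * cnj (L u) - (u * cnj u) * L u) / 4"
      by (simp add: power2_eq_square algebra_simps)
    finally show "Y u = of_real (Im (u * cnj (L u)) / 2) * (\<i> * u)"
      by (simp only: Y_def u mult_1_left)
  qed
  ultimately show ?thesis
    using sol unfolding tangential_solution_def extends_tangentially_def by blast
qed

text \<open>Harmonicity is defined by the existence of a deformation, so its stability under
  addition is not immediate. Here the holomorphic summand stays free in the explicit formula of
  \<open>prescribed_lie20\<close>.\<close>

lemma prescribed_lie20_affine:
  assumes f: "f holomorphic_on disc"
  obtains \<eta>0 where "\<And>h \<eta>. h holomorphic_on disc \<Longrightarrow> (\<And>z. z \<in> disc \<Longrightarrow> \<eta> z = \<eta>0 z + h z) \<Longrightarrow>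
    harmonic_vf disc \<eta> \<and> (\<forall>z\<in>disc. lie20 \<eta> z = f z)"
proof -
  have hol: "(\<lambda>z. f z / 8) holomorphic_on disc" "(\<lambda>z. z * f z / 8) holomorphic_on disc"
    "(\<lambda>z. z\<^sup>2 * f z / 8) holomorphic_on disc"
    by (intro holomorphic_intros f; simp)+
  obtain A where A: "\<And>z. z \<in> disc \<Longrightarrow> (A has_field_derivative f z / 8) (at z)"
    using holomorphic_disc_primitive[OF hol(1)] by blast
  obtain B where B: "\<And>z. z \<in> disc \<Longrightarrow> (B has_field_derivative z * f z / 8) (at z)"
    using holomorphic_disc_primitive[OF hol(2)] by blast
  obtain C where C: "\<And>z. z \<in> disc \<Longrightarrow> (C has_field_derivative z\<^sup>2 * f z / 8) (at z)"
    using holomorphic_disc_primitive[OF hol(3)] by blast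
  from prescribed_lie20[OF f A B C] show thesis
    by (intro that[of "\<lambda>z. cnj (A z) - 2 * z * cnj (B z) + z\<^sup>2 * cnj (C z)"]) auto
qed

text \<open>\<open>\<eta>\<close> differs from the explicit particular solution by a holomorphic
  field, because their (2,0)-parts agree; hence so does \<open>\<eta>'\<close>.\<close>

lemma harmonic_vf_add_holomorphic:
  assumes f: "f holomorphic_on disc"
    and \<eta>: "harmonic_vf disc \<eta>" "\<And>z. z \<in> disc \<Longrightarrow> lie20 \<eta> z = f z"
    and h: "(\<lambda>z. \<eta>' z - \<eta> z) holomorphic_on disc"
  shows "harmonic_vf disc \<eta>'" "\<And>z. z \<in> disc \<Longrightarrow> lie20 \<eta>' z = f z"
proof -
  obtain \<eta>0 where *: "\<And>h \<eta>. h holomorphic_on disc \<Longrightarrow> (\<And>z. z \<in> disc \<Longrightarrow> \<eta> z = \<eta>0 z + h z) \<Longrightarrow>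
    harmonic_vf disc \<eta> \<and> (\<forall>z\<in>disc. lie20 \<eta> z = f z)"
    using prescribed_lie20_affine[OF f] by blast
  have "harmonic_vf disc \<eta>0 \<and> (\<forall>z\<in>disc. lie20 \<eta>0 z = f z)"
    by (rule *[of "\<lambda>_. 0"]) (auto intro: holomorphic_intros)
  then have "(\<lambda>z. \<eta> z - \<eta>0 z) holomorphic_on disc"
    using \<eta> by (intro lie20_eq_imp_diff_holomorphic) (auto simp: harmonic_vf_def)
  then have "(\<lambda>z. (\<eta> z - \<eta>0 z) + (\<eta>' z - \<eta> z)) holomorphic_on disc"
    using h by (rule holomorphic_on_add)
  then have "harmonic_vf disc \<eta>' \<and> (\<forall>z\<in>disc. lie20 \<eta>' z = f z)"
    by (rule *) simp
  then show "harmonic_vf disc \<eta>'" "\<And>z. z \<in> disc \<Longrightarrow> lie20 \<eta>' z = f z" by blast+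
qed

text \<open>Both sides describe the fields c + i b z - cnj c z^2 with b real: the Killing equation
  yields this form through moments on an interior circle, tangential extension through moments on
  the boundary.\<close>

lemma killing_vf_iff:
  "killing_vf X \<longleftrightarrow> X holomorphic_on disc \<and> extends_tangentially X"
proof
  assume K: "killing_vf X"
  then have hol: "X holomorphic_on disc" by (rule killing_vf_imp_holomorphic)
  have "\<And>z. z \<in> disc \<Longrightarrow> 2 * (z \<bullet> X z) + (1 - (norm z)\<^sup>2) * Re (deriv X z) = 0"
    using K killing_vf_holomorphic_iff[OF hol] by blast
  from infinitesimal_isometry_quadratic[OF hol this]
  show "X holomorphic_on disc \<and> extends_tangentially X"
    using hol quadratic_extends_tangentially by blast
next
  assume X: "X holomorphic_on disc \<and> extends_tangentially X"
  then obtain c b where cb: "\<And>z. z \<in> disc \<Longrightarrow> X z = c + \<i> * of_real b * z - cnj c * z\<^sup>2"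
    using extends_tangentially_quadratic by blast
  have "2 * (z \<bullet> X z) + (1 - (norm z)\<^sup>2) * Re (deriv X z) = 0" if z: "z \<in> disc" for z
  proof -
    have "((\<lambda>z. c + \<i> * of_real b * z - cnj c * z\<^sup>2) has_field_derivative
        (\<i> * of_real b - 2 * cnj c * z)) (at z)"
      by (auto intro!: derivative_eq_intros)
    then have "(X has_field_derivative (\<i> * of_real b - 2 * cnj c * z)) (at z)"
      by (rule has_field_derivative_transform_within_open[OF _ open_ball z]) (simp add: cb)
    then have e1: "Re (deriv X z) = - 2 * Re (cnj c * z)"
      by (simp add: DERIV_imp_deriv)
    have e2: "z \<bullet> X z = (1 - (norm z)\<^sup>2) * Re (cnj c * z)"
      unfolding cmod_power2 cb[OF z] inner_complex_def
      by (simp add: power2_eq_square algebra_simps)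
    show ?thesis unfolding e1 e2 by (simp add: algebra_simps)
  qed
  then show "killing_vf X"
    using killing_vf_holomorphic_iff X by blast
qed

lemma norm_le_tensor_norm_quad_diff:
  assumes "z \<in> disc"
  shows "norm (f z) / conf z \<le> tensor_norm 2 (quad_diff f) z"
proof -
  \<comment> \<open>A single entry of the tensor already bounds |f| / conf.\<close>
  have "(norm (quad_diff f z [1, 1]))\<^sup>2 / conf z ^ 2
    \<le> (\<Sum>es | set es \<subseteq> Basis \<and> length es = 2. (norm (quad_diff f z es))\<^sup>2 / conf z ^ 2)"
    by (rule member_le_sum[where f = "\<lambda>es. (norm (quad_diff f z es))\<^sup>2 / conf z ^ 2"])
      (auto simp: Basis_complex_def intro: finite_lists_length_eq)
  then have "sqrt ((norm (f z) / conf z)\<^sup>2) \<le> tensor_norm 2 (quad_diff f) z"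
    unfolding tensor_norm_def by (intro real_sqrt_le_mono) (simp add: quad_diff_def power_divide)
  then show ?thesis using conf_pos[OF assms] by simp
qed

theorem theorem3:
  fixes f :: "complex \<Rightarrow> complex" and D :: real
  assumes "f holomorphic_on disc"
    and "D > 0" and "\<forall>z\<in>disc. tensor_norm 2 (quad_diff f) z \<le> D"
    and "bounded_tensor 3 (cov_deriv (quad_diff f))"
    and "bounded_tensor 4 (cov_deriv (cov_deriv (quad_diff f)))"
  shows "(\<exists>\<eta>. tangential_solution f \<eta>) \<and>
    (\<forall>\<eta>. tangential_solution f \<eta> \<longrightarrow>
      (\<forall>\<eta>'. tangential_solution f \<eta>' \<longleftrightarrow>
        (\<lambda>z. \<eta>' z - \<eta> z) holomorphic_on disc \<and> extends_tangentially (\<lambda>z. \<eta>' z - \<eta> z))) \<and>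
    (\<forall>\<eta>. tangential_solution f \<eta> \<longrightarrow>
      (\<forall>\<eta>'. tangential_solution f \<eta>' \<longleftrightarrow> killing_vf (\<lambda>z. \<eta>' z - \<eta> z)))"
proof -
  \<comment> \<open>The hyperbolic bound becomes a Euclidean growth rate, using 1 - |z| \<le> 1 -
    |z|^2.\<close>
  have "norm (f z) \<le> 4 * D / (1 - norm z)\<^sup>2" if z: "z \<in> disc" for z
  proof -
    have "norm (f z) / conf z \<le> D"
      using norm_le_tensor_norm_quad_diff[OF z, of f] assms(3) z by fastforce
    then have "norm (f z) \<le> D * conf z"
      using conf_pos[OF z] by (simp add: field_simps)
    also have "\<dots> = 4 * D / (1 - (norm z)\<^sup>2)\<^sup>2"
      by (simp add: conf_def)
    also have "\<dots> \<le> 4 * D / (1 - norm z)\<^sup>2"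
    proof -
      have "(norm z)\<^sup>2 \<le> norm z" using z by (simp add: power2_eq_square mult_left_le)
      then have "(1 - norm z)\<^sup>2 \<le> (1 - (norm z)\<^sup>2)\<^sup>2" using z by (intro power_mono) auto
      then show ?thesis
        using assms(2) z norm_disc[OF z] by (intro divide_left_mono mult_pos_pos zero_less_power) auto
    qed
    finally show ?thesis .
  qed
  then have "\<exists>\<eta>. tangential_solution f \<eta>"
    by (rule tangential_solution_exists[OF assms(1)])
  moreover have "tangential_solution f \<eta>' \<longleftrightarrow>
      (\<lambda>z. \<eta>' z - \<eta> z) holomorphic_on disc \<and> extends_tangentially (\<lambda>z. \<eta>' z - \<eta> z)"
    if \<eta>: "tangential_solution f \<eta>" for \<eta> \<eta>'
  proof
    assume \<eta>': "tangential_solution f \<eta>'"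
    have "(\<lambda>z. \<eta>' z - \<eta> z) holomorphic_on disc"
      using \<eta> \<eta>' unfolding tangential_solution_def
      by (intro lie20_eq_imp_diff_holomorphic) (auto simp: harmonic_vf_def)
    moreover have "extends_tangentially (\<lambda>z. \<eta>' z - \<eta> z)"
      using extends_tangentially_add_scaled[of \<eta>' \<eta> "- 1"] \<eta> \<eta>' unfolding tangential_solution_def by simp
    ultimately show "(\<lambda>z. \<eta>' z - \<eta> z) holomorphic_on disc \<and> extends_tangentially (\<lambda>z. \<eta>' z - \<eta> z)" ..
  next
    assume h: "(\<lambda>z. \<eta>' z - \<eta> z) holomorphic_on disc \<and> extends_tangentially (\<lambda>z. \<eta>' z - \<eta> z)"
    \<comment> \<open>Write \<open>\<eta>'\<close> as \<open>\<eta>\<close> plus the difference,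
      both of which extend tangentially.\<close>
    then have "extends_tangentially \<eta>'"
      using extends_tangentially_add_scaled[of \<eta> "\<lambda>z. \<eta>' z - \<eta> z" 1] \<eta>
      unfolding tangential_solution_def by simp
    then show "tangential_solution f \<eta>'"
      using harmonic_vf_add_holomorphic[OF assms(1), of \<eta> \<eta>'] h \<eta>
      unfolding tangential_solution_def by blast
  qed
  ultimately show ?thesis
    unfolding killing_vf_iff by blast
qed

end
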